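(* Let $J$ be a countable index set, let $c_j>0$ and $g_j\in L^2(\mathbb{R})$ for $j\in J$, and let $E\subset\mathbb{R}$ be a measurable set whose closure has Lebesgue measure zero. Suppose that $$\sum_{j\in J}\frac{1}{c_j}|\hat g_j(\cdot)|^2\in L^1_{\mathrm{loc}}(\mathbb{R}\setminus E).$$ Then the generalized shift-invariant system $\{T_{c_jk}g_j\}_{k\in\mathbb{Z},\,j\in J}$ satisfies the local integrability condition (LIC) with respect to $E$ if and only if $$\sum_{j\in J}|\hat g_j(\cdot)|^2\in L^1_{\mathrm{loc}}(\mathbb{R}\setminus E).$$
   Context: $T_cf(x)=f(x-c)$, and $\hat f(\gamma)=\int_{\mathbb{R}}f(x)e^{-2\pi i\gamma x}\,dx$ (extended to $L^2(\mathbb{R})$). A nonnegative measurable function belongs to $L^1_{\mathrm{loc}}(\mathbb{R}\setminus E)$ if it is integrable over every compact set $K\subset\mathbb{R}\setminus E$. Let $\mathcal{D}_E$ be the set of all $f\in L^2(\mathbb{R})$ such that $\operatorname{supp}\hat f$ is a compact subset of $\mathbb{R}\setminus E$ and $\hat f\in L^\infty(\mathbb{R})$. The system $\{T_{c_jk}g_j\}_{k\in\mathbb{Z},j\in J}$ satisfies the LIC with respect to $E$ if for all $f\in\mathcal{D}_E$ $$L(f):=\sum_{j\in J}\sum_{m\in\mathbb{Z}}\frac{1}{c_j}\int_{\operatorname{supp}\hat f}\bigl|\hat f(\gamma+c_j^{-1}m)\,\hat g_j(\gamma)\bigr|^2\,d\gamma<\infty .$$ *)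

theory Defs
  imports "HOL-Analysis.Analysis"
begin

text \<open>
  Elements of \<open>L\<^sup>p(\<real>)\<close> are represented by Lebesgue measurable functions. Every notion below
  that takes such a function as an argument is invariant under changes on a Lebesgue null set.
\<close>

definition L2 :: "(real \<Rightarrow> complex) set" where
  "L2 = {f \<in> borel_measurable lebesgue. integrable lebesgue (\<lambda>x. (norm (f x))\<^sup>2)}"

definition Linf :: "(real \<Rightarrow> complex) set" where
  "Linf = {f \<in> borel_measurable lebesgue. \<exists>B. AE x in lebesgue. norm (f x) \<le> B}"

definition L1_loc :: "real set \<Rightarrow> (real \<Rightarrow> ennreal) set" where
  "L1_loc U = {h \<in> borel_measurable lebesgue.
     \<forall>K. compact K \<longrightarrow> K \<subseteq> U \<longrightarrow> (\<integral>\<^sup>+x\<in>K. h x \<partial>lebesgue) < \<infinity>}"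

definition fourier_L1 :: "(real \<Rightarrow> complex) \<Rightarrow> real \<Rightarrow> complex" where
  "fourier_L1 f \<gamma> = (LINT x|lebesgue. f x * exp (- 2 * of_real pi * \<i> * of_real \<gamma> * of_real x))"

text \<open>
  The Fourier transform on \<open>L\<^sup>2\<close> is the continuous extension of \<open>fourier_L1\<close> restricted to
  \<open>L\<^sup>1 \<inter> L\<^sup>2\<close>. \<open>F\<close> is a transform of \<open>f\<close> if some sequence in \<open>L\<^sup>1 \<inter> L\<^sup>2\<close> tends to \<open>f\<close> in
  \<open>L\<^sup>2\<close> while the transforms of its members tend to \<open>F\<close> in \<open>L\<^sup>2\<close>. By Plancherel's theorem such
  an \<open>F\<close> exists for each \<open>f \<in> L\<^sup>2\<close> and is unique up to null sets, so \<open>fourier\<close> merely picks a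
  representative.
\<close>

definition is_fourier :: "(real \<Rightarrow> complex) \<Rightarrow> (real \<Rightarrow> complex) \<Rightarrow> bool" where
  "is_fourier f F \<longleftrightarrow> F \<in> L2 \<and>
     (\<exists>\<phi> :: nat \<Rightarrow> real \<Rightarrow> complex.
        (\<forall>n. integrable lebesgue (\<phi> n) \<and> \<phi> n \<in> L2) \<and>
        (\<lambda>n. \<integral>\<^sup>+x. ennreal ((norm (\<phi> n x - f x))\<^sup>2) \<partial>lebesgue) \<longlonglongrightarrow> 0 \<and>
        (\<lambda>n. \<integral>\<^sup>+\<gamma>. ennreal ((norm (fourier_L1 (\<phi> n) \<gamma> - F \<gamma>))\<^sup>2) \<partial>lebesgue) \<longlonglongrightarrow> 0)"

definition fourier :: "(real \<Rightarrow> complex) \<Rightarrow> real \<Rightarrow> complex" where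
  "fourier f = (SOME F. is_fourier f F)"

text \<open>
  The support of a class of functions modulo null sets: the complement of the largest open set
  on which the function vanishes almost everywhere.
\<close>

definition ess_supp :: "(real \<Rightarrow> complex) \<Rightarrow> real set" where
  "ess_supp F = - \<Union>{U. open U \<and> (AE x in lebesgue. x \<in> U \<longrightarrow> F x = 0)}"

definition D_space :: "real set \<Rightarrow> (real \<Rightarrow> complex) set" where
  "D_space E = {f \<in> L2. compact (ess_supp (fourier f)) \<and> ess_supp (fourier f) \<subseteq> - E \<and>
     fourier f \<in> Linf}"

text \<open>
  A generalized shift-invariant system \<open>{T\<^bsub>c j k\<^esub> (g j)}\<close>, indexed by \<open>k \<in> \<int>\<close> and \<open>j \<in> J\<close>,
  is given by its generating data \<open>J\<close>, \<open>c\<close>, \<open>g\<close>.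
\<close>

definition LIC_sum ::
  "'j set \<Rightarrow> ('j \<Rightarrow> real) \<Rightarrow> ('j \<Rightarrow> real \<Rightarrow> complex) \<Rightarrow> (real \<Rightarrow> complex) \<Rightarrow> ennreal" where
  "LIC_sum J c g f = (\<Sum>\<^sub>\<infinity>j\<in>J. \<Sum>\<^sub>\<infinity>m\<in>(UNIV :: int set). ennreal (1 / c j) *
     (\<integral>\<^sup>+\<gamma>\<in>ess_supp (fourier f).
        ennreal ((norm (fourier f (\<gamma> + inverse (c j) * of_int m) * fourier (g j) \<gamma>))\<^sup>2) \<partial>lebesgue))"

definition LIC ::
  "'j set \<Rightarrow> ('j \<Rightarrow> real) \<Rightarrow> ('j \<Rightarrow> real \<Rightarrow> complex) \<Rightarrow> real set \<Rightarrow> bool" where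
  "LIC J c g E \<longleftrightarrow> (\<forall>f\<in>D_space E. LIC_sum J c g f < \<infinity>)"

end

theory Submission
  imports Defs "HOL-Probability.Sinc_Integral"
begin

text \<open>
  After interchanging sums and integrals, \<open>L(f)\<close> is the integral over the support \<open>S\<close> of the
  transform \<open>F\<close> of \<open>f\<close> of the terms \<open>|G\<^sub>j(\<gamma>)|\<^sup>2 / c\<^sub>j\<close> times the sum over \<open>m\<close> of
  \<open>|F(\<gamma> + m / c\<^sub>j)|\<^sup>2\<close>, where \<open>G\<^sub>j\<close> is the transform of \<open>g\<^sub>j\<close>. An interval of length \<open>l\<close> contains
  \<open>c\<^sub>j l + O(1)\<close> points of each progression \<open>\<gamma> + m / c\<^sub>j\<close>, so the inner sum is at most of order
  \<open>c\<^sub>j + 1\<close> when \<open>F\<close> is bounded with bounded support, and at least of order \<open>c\<^sub>j - O(1)\<close> as soon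
  as \<open>|F|\<close> is bounded below on some interval, wherever that interval lies. By hypothesis the error
  terms contribute a finite amount. For the converse it thus suffices to find \<open>f\<close> in \<open>D_space E\<close> whose
  support contains almost all of a given compact set \<open>K\<close>: take an open \<open>U\<close> that contains
  \<open>K - closure E\<close> and whose closure is disjoint from \<open>E\<close>, and let \<open>F\<close> be a weighted sum of tent
  functions that is positive exactly on \<open>U\<close>.

  Tents are transforms of \<open>(1 - cos (r x)) / x\<^sup>2\<close>. The same functions, used as weights, bound the
  \<open>L\<^sup>2\<close> norm of a transform (up to a constant), which with the completeness of \<open>L\<^sup>2\<close> shows that
  \<open>fourier\<close> is well defined.
\<close>

subsection \<open>Fejer functions and their transforms\<close>

text \<open>Up to scaling this is the Fejer kernel of the line,
  \<open>2 * sin (r * x / 2) ^ 2 / x ^ 2\<close>. At \<open>x = 0\<close> division by zero gives the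
  value 0 instead of the limit \<open>r ^ 2 / 2\<close>; a single point does not affect the
  integrals.\<close>

definition fejer :: "real \<Rightarrow> real \<Rightarrow> real" where
  "fejer r x = (1 - cos (r * x)) / x\<^sup>2"

text \<open>The integral equals pi. It is carried along as a symbol, since the estimates are up to a
  constant factor.\<close>

definition fejer_const :: real where
  "fejer_const = (LINT x|lborel. fejer 1 x)"

lemma fejer_nonneg: "0 \<le> fejer r x"
  by (simp add: fejer_def)

lemma borel_measurable_fejer [measurable]: "fejer r \<in> borel_measurable borel"
  unfolding fejer_def[abs_def] by measurable

lemma one_minus_cos_le: "1 - cos (y::real) \<le> y\<^sup>2 / 2"
proof -
  have "1 - cos y = 2 * (sin (y / 2))\<^sup>2"
    using cos_double_sin[of "y / 2"] by simp
  also have "(sin (y / 2))\<^sup>2 \<le> (y / 2)\<^sup>2"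
    using abs_sin_x_le_abs_x[of "y / 2"] by (simp only: abs_le_square_iff)
  finally show ?thesis
    by (simp add: power_divide)
qed

lemma fejer_le: "fejer r x \<le> r\<^sup>2 / 2"
proof (cases "x = 0")
  case False
  then show ?thesis
    using one_minus_cos_le[of "r * x"] by (simp add: fejer_def divide_simps power_mult_distrib)
qed (simp add: fejer_def)

text \<open>Adding the uniform bound to the decay bound \<open>2 / x ^ 2\<close> yields one
  integrable majorant for the whole line.\<close>

lemma fejer_le_inverse: "fejer r x \<le> (r\<^sup>2 / 2 + 2) * inverse (1 + x\<^sup>2)"
proof -
  have "fejer r x * x\<^sup>2 \<le> 2"
    using cos_ge_minus_one[of "r * x"] by (simp add: fejer_def)
  with fejer_le[of r x] have "fejer r x * (1 + x\<^sup>2) \<le> r\<^sup>2 / 2 + 2"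
    by (simp add: algebra_simps)
  moreover have "0 < 1 + x\<^sup>2"
    by (simp add: add_pos_nonneg)
  ultimately show ?thesis
    by (simp add: field_simps)
qed

lemma integrable_fejer: "integrable lborel (fejer r)"
proof (rule Bochner_Integration.integrable_bound)
  have "integrable lborel (\<lambda>x::real. inverse (1 + x\<^sup>2))"
    using integrable_inverse_1_plus_square by (simp add: set_integrable_def)
  then show "integrable lborel (\<lambda>x. (r\<^sup>2 / 2 + 2) * inverse (1 + x\<^sup>2))"
    by (rule integrable_mult_right)
  show "AE x in lborel. norm (fejer r x) \<le> norm ((r\<^sup>2 / 2 + 2) * inverse (1 + x\<^sup>2))"
    using fejer_le_inverse[of r] fejer_nonneg[of r] by (intro AE_I2) (smt (verit) real_norm_def)
qed simp

text \<open>Substituting \<open>r * x\<close> in the integral for \<open>r = 1\<close> contributes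
  the Jacobian \<open>|r|\<close>, and the denominator contributes \<open>1 / r ^ 2\<close>; one
  factor \<open>|r|\<close> is left.\<close>

lemma integral_fejer: "(LINT x|lborel. fejer r x) = \<bar>r\<bar> * fejer_const"
proof (cases "r = 0")
  case True
  then show ?thesis by (simp add: fejer_def)
next
  case False
  have scale: "fejer 1 (0 + r * x) = inverse (r\<^sup>2) * fejer r x" for x
    using False by (simp add: fejer_def field_simps)
  have "fejer_const = \<bar>r\<bar> * (LINT x|lborel. inverse (r\<^sup>2) * fejer r x)"
    unfolding fejer_const_def using False
    by (subst lborel_integral_real_affine[of r _ 0]) (simp_all only: scale real_scaleR_def not_False_eq_True)
  then have "\<bar>r\<bar> * fejer_const = \<bar>r\<bar> * (\<bar>r\<bar> * (inverse (r\<^sup>2) * (LINT x|lborel. fejer r x)))"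
    by simp
  also have "\<dots> = (LINT x|lborel. fejer r x)"
    using False by (simp add: field_simps power2_eq_square abs_mult_self_eq)
  finally show ?thesis by simp
qed

text \<open>A nonnegative function with integral 0 vanishes almost everywhere, but
  \<open>fejer 1\<close> is positive on the unit interval because the cosine decreases strictly
  there.\<close>

lemma fejer_const_pos: "0 < fejer_const"
proof (rule ccontr)
  assume "\<not> 0 < fejer_const"
  moreover have "0 \<le> fejer_const"
    unfolding fejer_const_def by (simp add: fejer_nonneg)
  ultimately have "(LINT x|lborel. fejer 1 x) = 0"
    by (simp add: fejer_const_def)
  then have "AE x in lborel. fejer 1 x = 0"
    using integral_nonneg_eq_0_iff_AE[OF integrable_fejer[of 1]] by (simp add: fejer_nonneg)
  moreover have "fejer 1 x \<noteq> 0" if "x \<in> {0<..<1}" for x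
    using that cos_monotone_0_pi[of 0 x] pi_gt3 by (simp add: fejer_def)
  ultimately have "AE x in lborel. x \<notin> {0<..<1::real}"
    by (auto elim!: eventually_mono)
  then have "emeasure lborel {0<..<1::real} = 0"
    by (subst (asm) AE_iff_measurable[of "{0<..<1}"]) auto
  then show False by simp
qed

text \<open>
  Expanding \<open>(1 - cos (r x)) cos (u x)\<close> into cosines expresses the transform of \<open>fejer r\<close> through
  the integrals of \<open>fejer s\<close> for \<open>s = u + r\<close>, \<open>u - r\<close>, \<open>u\<close>.
\<close>

lemma integral_fejer_cos:
  assumes "0 \<le> r"
  shows "(LINT x|lborel. fejer r x * cos (u * x)) = fejer_const * max 0 (r - \<bar>u\<bar>)"
proof -
  have *: "fejer r x * cos (u * x)
      = (1/2) * fejer (u + r) x + (1/2) * fejer (u - r) x - fejer u x" for x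
  proof -
    have "(1 - cos (r * x)) * cos (u * x)
      = (1/2) * (1 - cos ((u + r) * x)) + (1/2) * (1 - cos ((u - r) * x)) - (1 - cos (u * x))"
      by (simp add: distrib_right left_diff_distrib cos_add cos_diff) (simp add: field_simps)
    moreover have "a / q * b = (1/2) * (c / q) + (1/2) * (d / q) - e / q"
      if "a * b = (1/2) * c + (1/2) * d - e" for a b c d e q :: real
      using arg_cong[OF that, of "\<lambda>t. t / q"] by (simp add: add_divide_distrib diff_divide_distrib)
    ultimately show ?thesis
      unfolding fejer_def by blast
  qed
  have "(LINT x|lborel. fejer r x * cos (u * x))
      = (1/2) * (\<bar>u + r\<bar> * fejer_const) + (1/2) * (\<bar>u - r\<bar> * fejer_const) - \<bar>u\<bar> * fejer_const"
    unfolding * by (simp add: integrable_fejer integral_fejer)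
  also have "\<dots> = fejer_const * ((\<bar>u + r\<bar> + \<bar>u - r\<bar>) / 2 - \<bar>u\<bar>)"
    by (simp add: algebra_simps add_divide_distrib)
  \<comment> \<open>For nonnegative \<open>r\<close> the half sum of \<open>|u + r|\<close> and
    \<open>|u - r|\<close> is the larger of \<open>|u|\<close> and \<open>r\<close>.\<close>
  also have "(\<bar>u + r\<bar> + \<bar>u - r\<bar>) / 2 - \<bar>u\<bar> = max 0 (r - \<bar>u\<bar>)"
    using assms by (auto simp: abs_if max_def field_simps)
  finally show ?thesis .
qed

text \<open>The integrand is odd.\<close>

lemma integral_fejer_sin: "(LINT x|lborel. fejer r x * sin (u * x)) = 0"
proof -
  have "(LINT x|lborel. fejer r x * sin (u * x))
      = (LINT x|lborel. fejer r (0 + (-1) * x) * sin (u * (0 + (-1) * x)))"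
    by (subst lborel_integral_real_affine[of "-1" _ 0]) auto
  also have "\<dots> = - (LINT x|lborel. fejer r x * sin (u * x))"
    by (simp add: fejer_def)
  finally show ?thesis by simp
qed

lemma integrable_mult_cis:
  assumes "integrable lborel (f :: real \<Rightarrow> complex)" "h \<in> borel_measurable borel"
  shows "integrable lborel (\<lambda>x. f x * cis (h x))"
proof (rule Bochner_Integration.integrable_bound[OF assms(1)])
  have [measurable]: "f \<in> borel_measurable borel" "h \<in> borel_measurable borel"
    using borel_measurable_integrable[OF assms(1)] assms(2) by simp_all
  show "(\<lambda>x. f x * cis (h x)) \<in> borel_measurable lborel"
    unfolding cis_conv_exp by measurable
qed (simp add: norm_mult)

lemma integral_fejer_cis:
  assumes "0 \<le> r"
  shows "(LINT x|lborel. of_real (fejer r x) * cis (u * x)) = of_real (fejer_const * max 0 (r - \<bar>u\<bar>))"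
proof -
  have int: "integrable lborel (\<lambda>x. of_real (fejer r x) * cis (u * x))"
    by (intro integrable_mult_cis) (simp_all add: integrable_fejer)
  show ?thesis
    by (rule complex_eqI)
       (use int integral_fejer_cos[OF assms, of u] integral_fejer_sin[of r u] in
         \<open>simp_all add: integral_Re[symmetric] integral_Im[symmetric]\<close>)
qed

subsection \<open>The Plancherel bound\<close>

lemma fourier_L1_eq_cis: "fourier_L1 f \<gamma> = (LINT x|lebesgue. f x * cis (- 2 * pi * \<gamma> * x))"
  by (simp add: fourier_L1_def cis_conv_exp mult_ac)

text \<open>Fubini's theorem is applied on \<open>lborel\<close>, so for Borel functions the
  integral over the completed measure is moved there.\<close>

lemma fourier_L1_eq_lborel:
  assumes [measurable]: "f \<in> borel_measurable borel"
  shows "fourier_L1 f \<gamma> = (LINT x|lborel. f x * cis (- 2 * pi * \<gamma> * x))"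
  unfolding fourier_L1_eq_cis cis_conv_exp by (rule integral_completion) measurable

lemma norm_fourier_L1_le: "norm (fourier_L1 f \<gamma>) \<le> (LINT x|lebesgue. norm (f x))"
proof -
  have "norm (fourier_L1 f \<gamma>) \<le> (LINT x|lebesgue. norm (f x * cis (- 2 * pi * \<gamma> * x)))"
    unfolding fourier_L1_eq_cis by (rule integral_norm_bound)
  then show ?thesis by (simp add: norm_mult)
qed

lemma borel_measurable_fourier_L1:
  assumes [measurable]: "f \<in> borel_measurable borel"
  shows "fourier_L1 f \<in> borel_measurable borel"
proof -
  have "(\<lambda>\<gamma>. LINT x|lborel. f x * cis (- 2 * pi * \<gamma> * x)) \<in> borel_measurable borel"
    unfolding cis_conv_exp by measurable
  then show ?thesis
    by (simp add: fourier_L1_eq_lborel[OF assms, abs_def])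
qed

text \<open>Prepares Fubini's theorem for products twisted by a phase: the phase has modulus 1, so
  the integrability of the two factors suffices.\<close>

lemma integrable_lborel_pair_mult:
  fixes f g :: "real \<Rightarrow> complex"
  assumes f: "integrable lborel f" and g: "integrable lborel g"
    and h [measurable]: "h \<in> borel_measurable (borel \<Otimes>\<^sub>M borel)"
  shows "integrable (lborel \<Otimes>\<^sub>M lborel) (\<lambda>(x, y). f x * g y * cis (h (x, y)))"
proof -
  have [measurable]: "f \<in> borel_measurable borel" "g \<in> borel_measurable borel"
    using f g by (auto dest: borel_measurable_integrable)
  show ?thesis
    unfolding cis_conv_exp split_beta
  proof (rule lborel_pair.Fubini_integrable)
    have "integrable lborel (\<lambda>x. norm (f x) * (LINT y|lborel. norm (g y)))"
      using f by (intro integrable_mult_left integrable_norm)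
    then show "integrable lborel (\<lambda>x. LINT y|lborel.
        norm (f (fst (x, y)) * g (snd (x, y)) * exp (\<i> * complex_of_real (h (fst (x, y), snd (x, y))))))"
      by (simp add: norm_mult)
    show "AE x in lborel. integrable lborel
        (\<lambda>y. f (fst (x, y)) * g (snd (x, y)) * exp (\<i> * complex_of_real (h (fst (x, y), snd (x, y)))))"
    proof (rule AE_I2)
      fix x
      have "integrable lborel (\<lambda>y. f x * (g y * cis (h (x, y))))"
        by (intro integrable_mult_right integrable_mult_cis g) measurable
      then show "integrable lborel
        (\<lambda>y. f (fst (x, y)) * g (snd (x, y)) * exp (\<i> * complex_of_real (h (fst (x, y), snd (x, y)))))"
        by (simp add: cis_conv_exp mult.assoc)
    qed
  qed measurable
qed

text \<open>Integrability is not assumed: a Bochner integral that does not exist has the default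
  value 0.\<close>

lemma norm_integral_le_nn_integral:
  fixes f :: "'a \<Rightarrow> 'b::{banach, second_countable_topology}"
  shows "ennreal (norm (integral\<^sup>L M f)) \<le> (\<integral>\<^sup>+x. ennreal (norm (f x)) \<partial>M)"
  by (cases "integrable M f") (auto simp: integral_norm_bound_ennreal not_integrable_integral_eq)

text \<open>The tent lies below a rectangle of height \<open>r\<close> and half-width
  \<open>r / (2 * pi)\<close>, whose area \<open>r ^ 2 / pi\<close> is at most
  \<open>r ^ 2\<close>.\<close>

lemma nn_integral_tent_le:
  assumes "0 \<le> r"
  shows "(\<integral>\<^sup>+t. ennreal (max 0 (r - \<bar>2 * pi * (t - s)\<bar>)) \<partial>lborel) \<le> ennreal (r\<^sup>2)"
proof -
  define \<rho> where "\<rho> = r / (2 * pi)"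
  have \<rho>: "0 \<le> \<rho>" "2 * pi * \<rho> = r"
    using assms pi_gt_zero by (auto simp: \<rho>_def)
  have "ennreal (max 0 (r - \<bar>2 * pi * (t - s)\<bar>)) \<le> ennreal r * indicator {s - \<rho>..s + \<rho>} t" for t
  proof (cases "t \<in> {s - \<rho>..s + \<rho>}")
    case False
    then have "\<rho> \<le> \<bar>t - s\<bar>" by auto
    then have "2 * pi * \<rho> \<le> 2 * pi * \<bar>t - s\<bar>" by simp
    then show ?thesis using \<rho> by (simp add: abs_mult max_def)
  qed (use assms in \<open>auto simp: max_def intro!: ennreal_leI\<close>)
  then have "(\<integral>\<^sup>+t. ennreal (max 0 (r - \<bar>2 * pi * (t - s)\<bar>)) \<partial>lborel)
      \<le> (\<integral>\<^sup>+t. ennreal r * indicator {s - \<rho>..s + \<rho>} t \<partial>lborel)"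
    by (intro nn_integral_mono)
  also have "\<dots> = ennreal (r * (2 * \<rho>))"
    using \<rho> assms by (simp add: nn_integral_cmult ennreal_mult)
  also have "r * (2 * \<rho>) \<le> r\<^sup>2"
  proof -
    have "2 * \<rho> \<le> 2 * pi * \<rho>" using \<rho>(1) pi_gt3 by (intro mult_right_mono) auto
    then show ?thesis using \<rho> assms by (simp add: power2_eq_square mult_left_mono)
  qed
  finally show ?thesis by (simp add: ennreal_leI)
qed

lemma borel_measurable_cnj [measurable]:
  "f \<in> borel_measurable M \<Longrightarrow> (\<lambda>x. cnj (f x)) \<in> borel_measurable M"
  by (rule measurable_compose[OF _ borel_measurable_continuous_onI]) (auto intro: continuous_intros)

text \<open>
  The transform of \<open>fejer r\<close> is nonnegative with integral of order \<open>r\<^sup>2\<close>, so after two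
  applications of Fubini's theorem the weighted bound is a Schur test.
\<close>

lemma nn_integral_fourier_L1_fejer_le:
  assumes f: "integrable lborel f" and r: "0 \<le> r"
  shows "(\<integral>\<^sup>+\<gamma>. ennreal ((norm (fourier_L1 f \<gamma>))\<^sup>2 * fejer r \<gamma>) \<partial>lborel)
    \<le> ennreal (fejer_const * r\<^sup>2) * (\<integral>\<^sup>+x. ennreal ((norm (f x))\<^sup>2) \<partial>lborel)"
proof -
  define F where "F = fourier_L1 f"
  \<comment> \<open>The value of \<open>integral_fejer_cis\<close> at
    \<open>u = 2 * pi * (t - s)\<close>: the kernel that remains once the frequency variable is
    integrated out.\<close>
  define k where "k s t = fejer_const * max 0 (r - \<bar>2 * pi * (t - s)\<bar>)" for s t
  have f_meas [measurable]: "f \<in> borel_measurable borel"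
    using f by (auto dest: borel_measurable_integrable)
  have F_eq: "F \<gamma> = (LINT x|lborel. f x * cis (- 2 * pi * \<gamma> * x))" for \<gamma>
    by (simp add: F_def fourier_L1_eq_lborel)
  have F_meas [measurable]: "F \<in> borel_measurable borel"
    unfolding F_def by (rule borel_measurable_fourier_L1) simp
  have k_nonneg: "0 \<le> k s t" for s t
    using fejer_const_pos by (simp add: k_def)
  \<comment> \<open>The transform is bounded by the L1 norm of \<open>f\<close>, so the weight makes
    the product integrable. This permits the exchange of integrals in \<open>outer\<close>.\<close>
  have F_int: "integrable lborel (\<lambda>\<gamma>. of_real (fejer r \<gamma>) * cnj (F \<gamma>))"
  proof (rule Bochner_Integration.integrable_bound)
    show "integrable lborel (\<lambda>\<gamma>. (LINT x|lebesgue. norm (f x)) * fejer r \<gamma>)"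
      by (intro integrable_mult_right integrable_fejer)
    show "AE \<gamma> in lborel. norm (of_real (fejer r \<gamma>) * cnj (F \<gamma>)) \<le> norm ((LINT x|lebesgue. norm (f x)) * fejer r \<gamma>)"
      using norm_fourier_L1_le[of f]
      by (intro AE_I2) (simp add: F_def norm_mult abs_mult mult.commute[of "\<bar>fejer r _\<bar>"] mult_right_mono)
  qed measurable
  \<comment> \<open>Write the conjugated transform as an integral over \<open>t\<close> and
    integrate over the frequency first; the frequency integral becomes the kernel.\<close>
  have inner: "(LINT \<gamma>|lborel. of_real (fejer r \<gamma>) * cnj (F \<gamma>) * cis (- 2 * pi * \<gamma> * s))
      = (LINT t|lborel. cnj (f t) * of_real (k s t))" for s
  proof -
    have "(LINT \<gamma>|lborel. of_real (fejer r \<gamma>) * cnj (F \<gamma>) * cis (- 2 * pi * \<gamma> * s))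
        = (LINT \<gamma>|lborel. LINT t|lborel. of_real (fejer r \<gamma>) * cnj (f t) * cis (2 * pi * (t - s) * \<gamma>))"
    proof (rule Bochner_Integration.integral_cong[OF refl])
      fix \<gamma>
      have "of_real (fejer r \<gamma>) * cnj (F \<gamma>) * cis (- 2 * pi * \<gamma> * s)
          = of_real (fejer r \<gamma>) * cis (- 2 * pi * \<gamma> * s) * (LINT t|lborel. cnj (f t * cis (- 2 * pi * \<gamma> * t)))"
        by (simp only: F_eq Bochner_Integration.integral_cnj mult_ac)
      also have "\<dots> = (LINT t|lborel. of_real (fejer r \<gamma>) * cis (- 2 * pi * \<gamma> * s) * cnj (f t * cis (- 2 * pi * \<gamma> * t)))"
        by simp
      also have "\<dots> = (LINT t|lborel. of_real (fejer r \<gamma>) * cnj (f t) * cis (2 * pi * (t - s) * \<gamma>))"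
      proof (rule Bochner_Integration.integral_cong[OF refl])
        fix t
        have "cis (- 2 * pi * \<gamma> * s) * cis (2 * pi * \<gamma> * t) = cis (2 * pi * (t - s) * \<gamma>)"
          by (simp add: cis_mult algebra_simps)
        then show "of_real (fejer r \<gamma>) * cis (- 2 * pi * \<gamma> * s) * cnj (f t * cis (- 2 * pi * \<gamma> * t))
            = of_real (fejer r \<gamma>) * cnj (f t) * cis (2 * pi * (t - s) * \<gamma>)"
          by (simp add: cis_cnj mult_ac)
      qed
      finally show "of_real (fejer r \<gamma>) * cnj (F \<gamma>) * cis (- 2 * pi * \<gamma> * s)
        = (LINT t|lborel. of_real (fejer r \<gamma>) * cnj (f t) * cis (2 * pi * (t - s) * \<gamma>))" .
    qed
    also have "\<dots> = (LINT t|lborel. LINT \<gamma>|lborel. of_real (fejer r \<gamma>) * cnj (f t) * cis (2 * pi * (t - s) * \<gamma>))"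
      using integrable_lborel_pair_mult[of "\<lambda>\<gamma>. of_real (fejer r \<gamma>)" "\<lambda>t. cnj (f t)" "\<lambda>(\<gamma>, t). 2 * pi * (t - s) * \<gamma>"]
      by (intro lborel_pair.Fubini_integral[symmetric]) (simp add: f integrable_fejer)
    also have "\<dots> = (LINT t|lborel. cnj (f t) * (LINT \<gamma>|lborel. of_real (fejer r \<gamma>) * cis (2 * pi * (t - s) * \<gamma>)))"
      by (subst integral_mult_right_zero[symmetric]) (simp only: mult_ac)
    also have "\<dots> = (LINT t|lborel. cnj (f t) * of_real (k s t))"
      by (simp only: integral_fejer_cis[OF r] k_def)
    finally show ?thesis .
  qed
  \<comment> \<open>The same exchange for the other factor turns the weighted square norm into a
    double integral of \<open>f s * cnj (f t)\<close> against the kernel.\<close>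
  have outer: "(LINT \<gamma>|lborel. F \<gamma> * (of_real (fejer r \<gamma>) * cnj (F \<gamma>)))
      = (LINT s|lborel. f s * (LINT t|lborel. cnj (f t) * of_real (k s t)))"
  proof -
    have "F \<gamma> * A = (LINT s|lborel. A * f s * cis (- 2 * pi * \<gamma> * s))" for A \<gamma>
      by (simp only: F_eq mult.assoc Bochner_Integration.integral_mult_right_zero) (rule mult.commute)
    then have "(LINT \<gamma>|lborel. F \<gamma> * (of_real (fejer r \<gamma>) * cnj (F \<gamma>)))
       = (LINT \<gamma>|lborel. LINT s|lborel. of_real (fejer r \<gamma>) * cnj (F \<gamma>) * f s * cis (- 2 * pi * \<gamma> * s))"
      by presburger
    also have "\<dots> = (LINT s|lborel. LINT \<gamma>|lborel. of_real (fejer r \<gamma>) * cnj (F \<gamma>) * f s * cis (- 2 * pi * \<gamma> * s))"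
      using integrable_lborel_pair_mult[OF F_int f, of "\<lambda>(\<gamma>, s). - 2 * pi * \<gamma> * s"]
      by (intro lborel_pair.Fubini_integral[symmetric]) simp
    also have "\<dots> = (LINT s|lborel. f s * (LINT \<gamma>|lborel. of_real (fejer r \<gamma>) * cnj (F \<gamma>) * cis (- 2 * pi * \<gamma> * s)))"
      by (subst integral_mult_right_zero[symmetric]) (simp only: mult_ac)
    finally show ?thesis unfolding inner .
  qed
  have FF: "F \<gamma> * (of_real (fejer r \<gamma>) * cnj (F \<gamma>)) = of_real ((norm (F \<gamma>))\<^sup>2 * fejer r \<gamma>)" for \<gamma>
    by (simp only: of_real_mult complex_norm_square) (simp only: mult_ac)
  have int: "integrable lborel (\<lambda>\<gamma>. (norm (F \<gamma>))\<^sup>2 * fejer r \<gamma>)"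
  proof (rule Bochner_Integration.integrable_bound)
    show "integrable lborel (\<lambda>\<gamma>. (LINT x|lebesgue. norm (f x))\<^sup>2 * fejer r \<gamma>)"
      by (intro integrable_mult_right integrable_fejer)
    show "AE \<gamma> in lborel. norm ((norm (F \<gamma>))\<^sup>2 * fejer r \<gamma>) \<le> norm ((LINT x|lebesgue. norm (f x))\<^sup>2 * fejer r \<gamma>)"
      using norm_fourier_L1_le[of f]
      by (intro AE_I2) (simp add: F_def abs_mult mult_right_mono power_mono)
  qed measurable
  \<comment> \<open>The kernel depends on \<open>s\<close> and \<open>t\<close> only through
    \<open>|t - s|\<close>, so the two halves of the Schur estimate are equal.\<close>
  have "(\<integral>\<^sup>+s. \<integral>\<^sup>+t. ennreal ((norm (f t))\<^sup>2 / 2) * ennreal (k s t) \<partial>lborel \<partial>lborel)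
      = (\<integral>\<^sup>+t. \<integral>\<^sup>+s. ennreal ((norm (f t))\<^sup>2 / 2) * ennreal (k s t) \<partial>lborel \<partial>lborel)"
    unfolding k_def by (rule lborel_pair.Fubini') measurable
  also have "\<dots> = (\<integral>\<^sup>+s. \<integral>\<^sup>+t. ennreal ((norm (f s))\<^sup>2 / 2) * ennreal (k s t) \<partial>lborel \<partial>lborel)"
    by (simp add: k_def abs_mult abs_minus_commute)
  finally have swap: "(\<integral>\<^sup>+s. \<integral>\<^sup>+t. ennreal ((norm (f t))\<^sup>2 / 2) * ennreal (k s t) \<partial>lborel \<partial>lborel)
      = (\<integral>\<^sup>+s. \<integral>\<^sup>+t. ennreal ((norm (f s))\<^sup>2 / 2) * ennreal (k s t) \<partial>lborel \<partial>lborel)" .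
  have bound: "(\<integral>\<^sup>+s. \<integral>\<^sup>+t. ennreal ((norm (f s))\<^sup>2 / 2) * ennreal (k s t) \<partial>lborel \<partial>lborel)
      \<le> ennreal (fejer_const * r\<^sup>2) * (\<integral>\<^sup>+s. ennreal ((norm (f s))\<^sup>2 / 2) \<partial>lborel)"
  proof -
    have "(\<integral>\<^sup>+t. ennreal ((norm (f s))\<^sup>2 / 2) * ennreal (k s t) \<partial>lborel)
        \<le> ennreal (fejer_const * r\<^sup>2) * ennreal ((norm (f s))\<^sup>2 / 2)" for s
    proof -
      have "(\<integral>\<^sup>+t. ennreal (k s t) \<partial>lborel)
          = ennreal fejer_const * (\<integral>\<^sup>+t. ennreal (max 0 (r - \<bar>2 * pi * (t - s)\<bar>)) \<partial>lborel)"
        using fejer_const_pos unfolding k_def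
        by (subst nn_integral_cmult[symmetric]) (auto simp: ennreal_mult')
      also have "\<dots> \<le> ennreal fejer_const * ennreal (r\<^sup>2)"
        by (intro mult_left_mono nn_integral_tent_le r) simp
      also have "\<dots> = ennreal (fejer_const * r\<^sup>2)"
        using fejer_const_pos by (simp add: ennreal_mult)
      finally have "ennreal ((norm (f s))\<^sup>2 / 2) * (\<integral>\<^sup>+t. ennreal (k s t) \<partial>lborel)
          \<le> ennreal ((norm (f s))\<^sup>2 / 2) * ennreal (fejer_const * r\<^sup>2)"
        by (intro mult_left_mono) auto
      moreover have "(\<lambda>t. ennreal (k s t)) \<in> borel_measurable lborel"
        unfolding k_def by measurable
      ultimately show ?thesis
        by (subst nn_integral_cmult) (simp_all add: mult.commute)
    qed
    then have "(\<integral>\<^sup>+s. \<integral>\<^sup>+t. ennreal ((norm (f s))\<^sup>2 / 2) * ennreal (k s t) \<partial>lborel \<partial>lborel)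
        \<le> (\<integral>\<^sup>+s. ennreal (fejer_const * r\<^sup>2) * ennreal ((norm (f s))\<^sup>2 / 2) \<partial>lborel)"
      by (intro nn_integral_mono)
    then show ?thesis by (simp add: nn_integral_cmult)
  qed
  have "(\<integral>\<^sup>+\<gamma>. ennreal ((norm (F \<gamma>))\<^sup>2 * fejer r \<gamma>) \<partial>lborel)
      = ennreal (LINT \<gamma>|lborel. (norm (F \<gamma>))\<^sup>2 * fejer r \<gamma>)"
    by (rule nn_integral_eq_integral[OF int]) (simp add: fejer_nonneg)
  also have "\<dots> \<le> ennreal (norm (LINT \<gamma>|lborel. F \<gamma> * (of_real (fejer r \<gamma>) * cnj (F \<gamma>))))"
    unfolding FF by (intro ennreal_leI) (simp only: integral_complex_of_real norm_of_real abs_ge_self)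
  also have "\<dots> = ennreal (norm (LINT s|lborel. f s * (LINT t|lborel. cnj (f t) * of_real (k s t))))"
    by (simp only: outer)
  also have "\<dots> \<le> (\<integral>\<^sup>+s. ennreal (norm (f s * (LINT t|lborel. cnj (f t) * of_real (k s t)))) \<partial>lborel)"
    by (rule norm_integral_le_nn_integral)
  also have "\<dots> \<le> (\<integral>\<^sup>+s. \<integral>\<^sup>+t. ennreal (norm (f s) * norm (f t) * k s t) \<partial>lborel \<partial>lborel)"
  proof (rule nn_integral_mono)
    fix s
    have "ennreal (norm (f s * (LINT t|lborel. cnj (f t) * of_real (k s t))))
        \<le> ennreal (norm (f s)) * (\<integral>\<^sup>+t. ennreal (norm (cnj (f t) * of_real (k s t))) \<partial>lborel)"
      by (subst norm_mult, subst ennreal_mult') (auto intro!: mult_left_mono norm_integral_le_nn_integral)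
    also have "\<dots> = (\<integral>\<^sup>+t. ennreal (norm (f s) * norm (f t) * k s t) \<partial>lborel)"
      by (subst nn_integral_cmult[symmetric])
         (auto simp: norm_mult k_nonneg k_def ennreal_mult'[symmetric] mult_ac abs_mult
               abs_of_pos[OF fejer_const_pos] intro!: nn_integral_cong)
    finally show "ennreal (norm (f s * (LINT t|lborel. cnj (f t) * of_real (k s t))))
        \<le> (\<integral>\<^sup>+t. ennreal (norm (f s) * norm (f t) * k s t) \<partial>lborel)" .
  qed
  \<comment> \<open>The product of two norms is at most half the sum of their squares, which leaves
    a single factor of \<open>f\<close> variable in each term.\<close>
  also have "\<dots> \<le> (\<integral>\<^sup>+s. \<integral>\<^sup>+t. ennreal ((norm (f s))\<^sup>2 / 2) * ennreal (k s t)
      + ennreal ((norm (f t))\<^sup>2 / 2) * ennreal (k s t) \<partial>lborel \<partial>lborel)"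
  proof (intro nn_integral_mono)
    fix s t
    have "norm (f s) * norm (f t) * k s t \<le> ((norm (f s))\<^sup>2 / 2 + (norm (f t))\<^sup>2 / 2) * k s t"
      using sum_squares_bound[of "norm (f s)" "norm (f t)"] by (intro mult_right_mono k_nonneg) simp
    then show "ennreal (norm (f s) * norm (f t) * k s t)
        \<le> ennreal ((norm (f s))\<^sup>2 / 2) * ennreal (k s t) + ennreal ((norm (f t))\<^sup>2 / 2) * ennreal (k s t)"
      by (simp add: k_nonneg ennreal_mult'[symmetric] ennreal_plus[symmetric] distrib_right ennreal_leI
               del: ennreal_plus)
  qed
  also have "\<dots> = (\<integral>\<^sup>+s. \<integral>\<^sup>+t. ennreal ((norm (f s))\<^sup>2 / 2) * ennreal (k s t) \<partial>lborel \<partial>lborel)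
      + (\<integral>\<^sup>+s. \<integral>\<^sup>+t. ennreal ((norm (f t))\<^sup>2 / 2) * ennreal (k s t) \<partial>lborel \<partial>lborel)"
    unfolding k_def by (subst nn_integral_add[symmetric], measurable, subst nn_integral_add[symmetric], measurable)
  also have "\<dots> \<le> ennreal (fejer_const * r\<^sup>2) * (\<integral>\<^sup>+s. ennreal ((norm (f s))\<^sup>2 / 2) \<partial>lborel)
      + ennreal (fejer_const * r\<^sup>2) * (\<integral>\<^sup>+s. ennreal ((norm (f s))\<^sup>2 / 2) \<partial>lborel)"
    unfolding swap by (intro add_mono bound)
  finally have "(\<integral>\<^sup>+\<gamma>. ennreal ((norm (F \<gamma>))\<^sup>2 * fejer r \<gamma>) \<partial>lborel)
      \<le> ennreal (fejer_const * r\<^sup>2) * (2 * (\<integral>\<^sup>+s. ennreal ((norm (f s))\<^sup>2 / 2) \<partial>lborel))"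
    by (simp add: distrib_left mult_2)
  also have "2 * (\<integral>\<^sup>+s. ennreal ((norm (f s))\<^sup>2 / 2) \<partial>lborel) = (\<integral>\<^sup>+x. ennreal ((norm (f x))\<^sup>2) \<partial>lborel)"
    by (subst nn_integral_cmult[symmetric]) (auto simp: ennreal_mult'[symmetric, of 2, simplified])
  finally show ?thesis by (simp add: F_def)
qed

text \<open>The weighted bound with \<open>r = 1 / n\<close>, multiplied by
  \<open>2 * n ^ 2\<close>, has the same constant for every positive \<open>n\<close>, while the
  weights tend to 1 away from 0. Fatou's lemma then removes the weight.\<close>

lemma Plancherel_bound:
  assumes f: "integrable lborel f"
  shows "(\<integral>\<^sup>+\<gamma>. ennreal ((norm (fourier_L1 f \<gamma>))\<^sup>2) \<partial>lborel)
    \<le> ennreal (2 * fejer_const) * (\<integral>\<^sup>+x. ennreal ((norm (f x))\<^sup>2) \<partial>lborel)"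
proof -
  \<comment> \<open>Since \<open>1 - cos y\<close> is close to \<open>y ^ 2 / 2\<close> for small
    \<open>y\<close>, \<open>fejer (1 / n)\<close> is close to \<open>1 / (2 * n ^ 2)\<close> at
    each fixed nonzero point; the factor normalises this to 1.\<close>
  define w where "w n \<gamma> = 2 * (real n)\<^sup>2 * fejer (1 / real n) \<gamma>" for n \<gamma>
  have [measurable]: "fourier_L1 f \<in> borel_measurable borel" "f \<in> borel_measurable borel"
    using f by (auto intro!: borel_measurable_fourier_L1 dest: borel_measurable_integrable)
  have lim: "(\<lambda>n. w n \<gamma>) \<longlonglongrightarrow> 1" if "\<gamma> \<noteq> 0" for \<gamma>
  proof -
    have "(\<lambda>n. 2 * (real n)\<^sup>2 * (1 - cos (1 / real n * \<gamma>))) \<longlonglongrightarrow> \<gamma>\<^sup>2"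
      by (real_asymp simp: power2_eq_square)
    from tendsto_divide[OF this tendsto_const[of "\<gamma>\<^sup>2"]] that show ?thesis
      by (simp add: w_def fejer_def)
  qed
  have w_nonneg: "0 \<le> w n \<gamma>" for n \<gamma>
    by (simp add: w_def fejer_nonneg)
  have "(\<integral>\<^sup>+\<gamma>. ennreal ((norm (fourier_L1 f \<gamma>))\<^sup>2) \<partial>lborel)
      = (\<integral>\<^sup>+\<gamma>. liminf (\<lambda>n. ennreal ((norm (fourier_L1 f \<gamma>))\<^sup>2 * w n \<gamma>)) \<partial>lborel)"
  proof (rule nn_integral_cong_AE)
    show "AE \<gamma> in lborel. ennreal ((norm (fourier_L1 f \<gamma>))\<^sup>2)
        = liminf (\<lambda>n. ennreal ((norm (fourier_L1 f \<gamma>))\<^sup>2 * w n \<gamma>))"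
      using AE_lborel_singleton[of 0]
    proof eventually_elim
      fix \<gamma> :: real
      assume "\<gamma> \<noteq> 0"
      from tendsto_mult_left[OF lim[OF this], of "(norm (fourier_L1 f \<gamma>))\<^sup>2"]
      have "(\<lambda>n. ennreal ((norm (fourier_L1 f \<gamma>))\<^sup>2 * w n \<gamma>)) \<longlonglongrightarrow> ennreal ((norm (fourier_L1 f \<gamma>))\<^sup>2)"
        by (intro tendsto_ennrealI) simp
      then show "ennreal ((norm (fourier_L1 f \<gamma>))\<^sup>2)
        = liminf (\<lambda>n. ennreal ((norm (fourier_L1 f \<gamma>))\<^sup>2 * w n \<gamma>))"
        by (intro lim_imp_Liminf[symmetric]) simp_all
    qed
  qed
  also have "\<dots> \<le> liminf (\<lambda>n. \<integral>\<^sup>+\<gamma>. ennreal ((norm (fourier_L1 f \<gamma>))\<^sup>2 * w n \<gamma>) \<partial>lborel)"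
    unfolding w_def by (rule nn_integral_liminf) measurable
  also have "\<dots> \<le> ennreal (2 * fejer_const) * (\<integral>\<^sup>+x. ennreal ((norm (f x))\<^sup>2) \<partial>lborel)"
  proof -
    have "(\<integral>\<^sup>+\<gamma>. ennreal ((norm (fourier_L1 f \<gamma>))\<^sup>2 * w n \<gamma>) \<partial>lborel)
        \<le> ennreal (2 * fejer_const) * (\<integral>\<^sup>+x. ennreal ((norm (f x))\<^sup>2) \<partial>lborel)" for n
    proof -
      have "(\<integral>\<^sup>+\<gamma>. ennreal ((norm (fourier_L1 f \<gamma>))\<^sup>2 * w n \<gamma>) \<partial>lborel)
          = ennreal (2 * (real n)\<^sup>2) * (\<integral>\<^sup>+\<gamma>. ennreal ((norm (fourier_L1 f \<gamma>))\<^sup>2 * fejer (1 / real n) \<gamma>) \<partial>lborel)"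
        unfolding w_def
        by (subst nn_integral_cmult[symmetric]) (auto simp: ennreal_mult'[symmetric] mult_ac)
      also have "\<dots> \<le> ennreal (2 * (real n)\<^sup>2) * (ennreal (fejer_const * (1 / real n)\<^sup>2)
          * (\<integral>\<^sup>+x. ennreal ((norm (f x))\<^sup>2) \<partial>lborel))"
        by (intro mult_left_mono nn_integral_fourier_L1_fejer_le f) simp_all
      also have "\<dots> = ennreal (2 * (real n)\<^sup>2 * (fejer_const * (1 / real n)\<^sup>2))
          * (\<integral>\<^sup>+x. ennreal ((norm (f x))\<^sup>2) \<partial>lborel)"
        using fejer_const_pos by (simp add: ennreal_mult' mult.assoc)
      \<comment> \<open>Equality holds for positive \<open>n\<close>; at \<open>n = 0\<close> the
        left side is 0.\<close>
      also have "\<dots> \<le> ennreal (2 * fejer_const) * (\<integral>\<^sup>+x. ennreal ((norm (f x))\<^sup>2) \<partial>lborel)"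
        using fejer_const_pos
        by (intro mult_right_mono ennreal_leI) (simp_all add: power_divide)
      finally show ?thesis .
    qed
    then show ?thesis
      by (intro Liminf_le) (auto intro!: always_eventually)
  qed
  finally show ?thesis .
qed

section \<open>Squared L2 distances and completeness\<close>

lemma norm_add_square_le: "(norm (a + b))\<^sup>2 \<le> 2 * (norm a)\<^sup>2 + 2 * (norm (b::'a::real_normed_vector))\<^sup>2"
proof -
  have "(norm (a + b))\<^sup>2 \<le> (norm a + norm b)\<^sup>2"
    by (intro power_mono norm_triangle_ineq) simp
  also have "\<dots> \<le> 2 * (norm a)\<^sup>2 + 2 * (norm b)\<^sup>2"
    using sum_squares_bound[of "norm a" "norm b"] by (simp add: power2_sum)
  finally show ?thesis .
qed

text \<open>Serves as the triangle inequality for squared L2 norms; the factors 2 replace the square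
  roots of Minkowski's inequality.\<close>

lemma nn_integral_norm_add_square_le:
  fixes f g :: "'a \<Rightarrow> 'b::{real_normed_vector, second_countable_topology}"
  assumes [measurable]: "f \<in> borel_measurable M" "g \<in> borel_measurable M"
  shows "(\<integral>\<^sup>+x. ennreal ((norm (f x + g x))\<^sup>2) \<partial>M)
    \<le> 2 * (\<integral>\<^sup>+x. ennreal ((norm (f x))\<^sup>2) \<partial>M) + 2 * (\<integral>\<^sup>+x. ennreal ((norm (g x))\<^sup>2) \<partial>M)"
proof -
  have "ennreal ((norm (f x + g x))\<^sup>2) \<le> 2 * ennreal ((norm (f x))\<^sup>2) + 2 * ennreal ((norm (g x))\<^sup>2)" for x
    using ennreal_leI[OF norm_add_square_le[of "f x" "g x"]] by (simp add: ennreal_mult')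
  then have "(\<integral>\<^sup>+x. ennreal ((norm (f x + g x))\<^sup>2) \<partial>M)
      \<le> (\<integral>\<^sup>+x. 2 * ennreal ((norm (f x))\<^sup>2) + 2 * ennreal ((norm (g x))\<^sup>2) \<partial>M)"
    by (rule nn_integral_mono)
  then show ?thesis
    by (simp add: nn_integral_add nn_integral_cmult)
qed

text \<open>
  Since \<open>2 d \<le> 2\<^sup>n d\<^sup>2 + 2\<^sup>-\<^sup>n\<close>, weighting the squared increments by \<open>2\<^sup>n\<close> makes the increments
  absolutely summable almost everywhere.
\<close>

lemma Riesz_Fischer:
  fixes F :: "nat \<Rightarrow> 'a \<Rightarrow> 'b::{banach, second_countable_topology}"
  assumes meas [measurable]: "\<And>n. F n \<in> borel_measurable M" and "0 \<le> K"
    and cauchy: "\<And>n m. n \<le> m \<Longrightarrow>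
      (\<integral>\<^sup>+x. ennreal ((norm (F m x - F n x))\<^sup>2) \<partial>M) \<le> ennreal (K / 4 ^ n)"
  obtains G where "G \<in> borel_measurable M"
    "\<And>n. (\<integral>\<^sup>+x. ennreal ((norm (F n x - G x))\<^sup>2) \<partial>M) \<le> ennreal (K / 4 ^ n)"
proof
  \<comment> \<open>Where the sequence diverges, \<open>lim\<close> still returns some value; this
    happens only on a null set.\<close>
  define G where "G x = lim (\<lambda>n. F n x)" for x
  define d where "d n x = norm (F (Suc n) x - F n x)" for n x
  have d_meas [measurable]: "d n \<in> borel_measurable M" for n
    unfolding d_def by measurable
  show [measurable]: "G \<in> borel_measurable M"
    unfolding G_def by measurable
  have "(\<integral>\<^sup>+x. (\<Sum>n. ennreal (2 ^ n * (d n x)\<^sup>2)) \<partial>M) = (\<Sum>n. \<integral>\<^sup>+x. ennreal (2 ^ n * (d n x)\<^sup>2) \<partial>M)"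
    by (rule nn_integral_suminf) measurable
  also have "\<dots> \<le> (\<Sum>n. ennreal (K * (1 / 2) ^ n))"
  proof (rule suminf_le)
    fix n
    have "(\<integral>\<^sup>+x. ennreal (2 ^ n * (d n x)\<^sup>2) \<partial>M) = ennreal (2 ^ n) * (\<integral>\<^sup>+x. ennreal ((d n x)\<^sup>2) \<partial>M)"
      by (subst nn_integral_cmult[symmetric]) (auto simp: ennreal_mult'[symmetric])
    also have "\<dots> \<le> ennreal (2 ^ n) * ennreal (K / 4 ^ n)"
      using cauchy[of n "Suc n"] by (intro mult_left_mono) (simp_all add: d_def)
    also have "\<dots> = ennreal (K * (1 / 2) ^ n)"
      using \<open>0 \<le> K\<close> by (simp add: ennreal_mult[symmetric] power_divide field_simps power_mult_distrib[symmetric])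
    finally show "(\<integral>\<^sup>+x. ennreal (2 ^ n * (d n x)\<^sup>2) \<partial>M) \<le> ennreal (K * (1 / 2) ^ n)" .
  qed simp_all
  also have "\<dots> < \<infinity>"
    using \<open>0 \<le> K\<close> summable_mult[OF summable_geometric[of "1 / 2 :: real"], of K]
    by (subst suminf_ennreal2) auto
  finally have "AE x in M. (\<Sum>n. ennreal (2 ^ n * (d n x)\<^sup>2)) \<noteq> \<infinity>"
    by (intro nn_integral_PInf_AE) auto
  then have lim: "AE x in M. (\<lambda>n. F n x) \<longlonglongrightarrow> G x"
  proof eventually_elim
    fix x
    assume "(\<Sum>n. ennreal (2 ^ n * (d n x)\<^sup>2)) \<noteq> \<infinity>"
    then have "summable (\<lambda>n. 2 ^ n * (d n x)\<^sup>2)"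
      by (intro summable_suminf_not_top) (auto simp: infinity_ennreal_def)
    then have "summable (\<lambda>n. 2 ^ n * (d n x)\<^sup>2 + (1 / 2) ^ n)"
      by (intro summable_add summable_geometric) auto
    then have "summable (\<lambda>n. norm (F (Suc n) x - F n x))"
    proof (rule summable_comparison_test'[of _ 0])
      fix n
      have "0 \<le> (2 ^ n * d n x - 1)\<^sup>2 * (1 / 2) ^ n"
        by (intro mult_nonneg_nonneg) auto
      also have "\<dots> = 2 ^ n * (d n x)\<^sup>2 + (1 / 2) ^ n - 2 * d n x"
        by (simp add: power2_eq_square field_simps)
      finally show "norm (norm (F (Suc n) x - F n x)) \<le> 2 ^ n * (d n x)\<^sup>2 + (1 / 2) ^ n"
        using norm_ge_zero[of "F (Suc n) x - F n x"] unfolding d_def real_norm_def abs_norm_cancel by linarith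
    qed
    then have "summable (\<lambda>n. F (Suc n) x - F n x)"
      by (rule summable_norm_cancel)
    then have "convergent (\<lambda>n. \<Sum>k<n. F (Suc k) x - F k x)"
      by (simp add: summable_iff_convergent)
    then have "convergent (\<lambda>n. F n x - F 0 x)"
      by (simp only: sum_lessThan_telescope[of "\<lambda>n. F n x"])
    then have "convergent (\<lambda>n. F n x)"
      using convergent_diff_const_right_iff by blast
    then show "(\<lambda>n. F n x) \<longlonglongrightarrow> G x"
      by (simp add: G_def convergent_LIMSEQ_iff)
  qed
  fix n
  \<comment> \<open>Let the later index tend to infinity in the Cauchy estimate; Fatou's lemma
    passes the bound to the limit.\<close>
  have "(\<integral>\<^sup>+x. ennreal ((norm (F n x - G x))\<^sup>2) \<partial>M)
      = (\<integral>\<^sup>+x. liminf (\<lambda>m. ennreal ((norm (F m x - F n x))\<^sup>2)) \<partial>M)"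
  proof (rule nn_integral_cong_AE, use lim in eventually_elim)
    fix x
    assume "(\<lambda>m. F m x) \<longlonglongrightarrow> G x"
    then have "(\<lambda>m. ennreal ((norm (F m x - F n x))\<^sup>2)) \<longlonglongrightarrow> ennreal ((norm (G x - F n x))\<^sup>2)"
      by (intro tendsto_intros tendsto_ennrealI)
    then show "ennreal ((norm (F n x - G x))\<^sup>2) = liminf (\<lambda>m. ennreal ((norm (F m x - F n x))\<^sup>2))"
      by (subst norm_minus_commute) (intro lim_imp_Liminf[symmetric], simp_all)
  qed
  also have "\<dots> \<le> liminf (\<lambda>m. \<integral>\<^sup>+x. ennreal ((norm (F m x - F n x))\<^sup>2) \<partial>M)"
    by (rule nn_integral_liminf) measurable
  also have "\<dots> \<le> ennreal (K / 4 ^ n)"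
    by (intro Liminf_le eventually_sequentiallyI[of n] cauchy) simp_all
  finally show "(\<integral>\<^sup>+x. ennreal ((norm (F n x - G x))\<^sup>2) \<partial>M) \<le> ennreal (K / 4 ^ n)" .
qed

section \<open>From Borel to Lebesgue measurable functions\<close>

lemma lebesgue_ex_borel_complex:
  fixes f :: "real \<Rightarrow> complex"
  assumes [measurable]: "f \<in> borel_measurable lebesgue"
  obtains g where "g \<in> borel_measurable borel" "AE x in lebesgue. f x = g x"
proof -
  obtain u where u: "u \<in> borel_measurable lborel" "AE x in lborel. Re (f x) = u x"
    using completion_ex_borel_measurable_real[of "\<lambda>x. Re (f x)" lborel] by auto
  obtain v where v: "v \<in> borel_measurable lborel" "AE x in lborel. Im (f x) = v x"
    using completion_ex_borel_measurable_real[of "\<lambda>x. Im (f x)" lborel] by auto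
  show thesis
  proof
    show "(\<lambda>x. Complex (u x) (v x)) \<in> borel_measurable borel"
      using u v by (simp add: borel_measurable_complex_iff)
    have "AE x in lborel. f x = Complex (u x) (v x)"
      using u(2) v(2) by eventually_elim (simp add: complex_eq_iff)
    then show "AE x in lebesgue. f x = Complex (u x) (v x)"
      by (rule AE_completion)
  qed
qed

lemma fourier_L1_cong_AE:
  assumes "AE x in lebesgue. f x = g x"
    and [measurable]: "f \<in> borel_measurable lebesgue" "g \<in> borel_measurable lebesgue"
  shows "fourier_L1 f = fourier_L1 g"
proof
  fix \<gamma>
  have [measurable]: "(\<lambda>x. cis (- 2 * pi * \<gamma> * x)) \<in> borel_measurable lebesgue"
    unfolding cis_conv_exp by (rule measurable_completion) measurable
  show "fourier_L1 f \<gamma> = fourier_L1 g \<gamma>"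
    unfolding fourier_L1_eq_cis by (rule integral_cong_AE; measurable) (use assms(1) in auto)
qed

lemma fourier_L1_diff:
  assumes "integrable lebesgue f" "integrable lebesgue g"
  shows "fourier_L1 (\<lambda>x. f x - g x) \<gamma> = fourier_L1 f \<gamma> - fourier_L1 g \<gamma>"
proof -
  have "integrable lebesgue (\<lambda>x. h x * cis (- 2 * pi * \<gamma> * x))" if h: "integrable lebesgue h" for h
  proof (rule Bochner_Integration.integrable_bound[OF h])
    have [measurable]: "h \<in> borel_measurable lebesgue"
      using h by (rule borel_measurable_integrable)
    have [measurable]: "(\<lambda>x. cis (- 2 * pi * \<gamma> * x)) \<in> borel_measurable lebesgue"
      unfolding cis_conv_exp by (rule measurable_completion) measurable
    show "(\<lambda>x. h x * cis (- 2 * pi * \<gamma> * x)) \<in> borel_measurable lebesgue"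
      by measurable
  qed (simp add: norm_mult)
  from Bochner_Integration.integral_diff[OF this[OF assms(1)] this[OF assms(2)]]
  show ?thesis
    unfolding fourier_L1_eq_cis by (simp add: left_diff_distrib)
qed

text \<open>A Borel representative has the same transform at every point, so the estimates on
  \<open>lborel\<close> carry over to Lebesgue measurable functions.\<close>

lemma lebesgue_integrable_borel_representative:
  fixes f :: "real \<Rightarrow> complex"
  assumes f: "integrable lebesgue f"
  obtains g where "integrable lborel g" "g \<in> borel_measurable borel" "AE x in lebesgue. f x = g x"
    "fourier_L1 f = fourier_L1 g"
proof -
  have f_meas [measurable]: "f \<in> borel_measurable lebesgue"
    using f by (rule borel_measurable_integrable)
  obtain g where g [measurable]: "g \<in> borel_measurable borel" and fg: "AE x in lebesgue. f x = g x"
    using lebesgue_ex_borel_complex[OF f_meas] .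
  have g' [measurable]: "g \<in> borel_measurable lebesgue"
    using g by (intro measurable_completion) simp
  have "integrable lebesgue g"
    using f integrable_cong_AE[OF f_meas g' fg] by blast
  then have "integrable lborel g"
    by (simp add: integrable_completion)
  with g fg fourier_L1_cong_AE[OF fg f_meas g'] that show thesis by blast
qed

lemma borel_measurable_fourier_L1_lebesgue:
  assumes "integrable lebesgue f"
  shows "fourier_L1 f \<in> borel_measurable borel"
  using lebesgue_integrable_borel_representative[OF assms] borel_measurable_fourier_L1 by metis

lemma Plancherel_bound_lebesgue:
  assumes f: "integrable lebesgue f"
  shows "(\<integral>\<^sup>+\<gamma>. ennreal ((norm (fourier_L1 f \<gamma>))\<^sup>2) \<partial>lebesgue)
    \<le> ennreal (2 * fejer_const) * (\<integral>\<^sup>+x. ennreal ((norm (f x))\<^sup>2) \<partial>lebesgue)"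
proof -
  obtain g where g: "integrable lborel g" "AE x in lebesgue. f x = g x" "fourier_L1 f = fourier_L1 g"
    using lebesgue_integrable_borel_representative[OF f] .
  have "(\<integral>\<^sup>+x. ennreal ((norm (f x))\<^sup>2) \<partial>lebesgue) = (\<integral>\<^sup>+x. ennreal ((norm (g x))\<^sup>2) \<partial>lebesgue)"
    using g(2) by (intro nn_integral_cong_AE) auto
  with Plancherel_bound[OF g(1)] show ?thesis
    by (simp add: g(3) nn_integral_completion)
qed

section \<open>The Fourier transform on L2\<close>

lemma L2_iff: "f \<in> L2 \<longleftrightarrow> f \<in> borel_measurable lebesgue \<and> (\<integral>\<^sup>+x. ennreal ((norm (f x))\<^sup>2) \<partial>lebesgue) < \<infinity>"
  by (auto simp: L2_def integrable_iff_bounded)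

lemma is_fourier_cong_AE:
  assumes "AE x in lebesgue. f x = g x"
  shows "is_fourier f F \<longleftrightarrow> is_fourier g F"
proof -
  have "(\<integral>\<^sup>+x. ennreal ((norm (\<phi> x - f x))\<^sup>2) \<partial>lebesgue) = (\<integral>\<^sup>+x. ennreal ((norm (\<phi> x - g x))\<^sup>2) \<partial>lebesgue)" for \<phi>
    using assms by (intro nn_integral_cong_AE) auto
  then show ?thesis by (simp add: is_fourier_def)
qed

text \<open>The constant sequence \<open>f\<close> approximates \<open>f\<close>, and the Plancherel
  bound puts its transform in L2.\<close>

lemma is_fourier_L1:
  assumes "integrable lebesgue f" "f \<in> L2"
  shows "is_fourier f (fourier_L1 f)"
proof -
  have "(\<integral>\<^sup>+\<gamma>. ennreal ((norm (fourier_L1 f \<gamma>))\<^sup>2) \<partial>lebesgue) < \<infinity>"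
    using Plancherel_bound_lebesgue[OF assms(1)] assms(2)
    by (auto simp: L2_iff ennreal_mult_less_top intro: le_less_trans)
  then have "fourier_L1 f \<in> L2"
    using borel_measurable_fourier_L1_lebesgue[OF assms(1)] by (auto simp: L2_iff intro: measurable_completion)
  then show ?thesis
    unfolding is_fourier_def using assms by (intro conjI exI[of _ "\<lambda>_. f"]) auto
qed

text \<open>Two sequences approximating \<open>f\<close> are close to each other in L2; by the
  Plancherel bound so are their transforms, hence the two limits agree.\<close>

lemma is_fourier_unique_AE:
  assumes f: "f \<in> L2" and F: "is_fourier f F" and G: "is_fourier f G"
  shows "AE \<gamma> in lebesgue. F \<gamma> = G \<gamma>"
proof -
  from F obtain \<phi> where \<phi>: "\<And>n. integrable lebesgue (\<phi> n)"
    "(\<lambda>n. \<integral>\<^sup>+x. ennreal ((norm (\<phi> n x - f x))\<^sup>2) \<partial>lebesgue) \<longlonglongrightarrow> 0"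
    "(\<lambda>n. \<integral>\<^sup>+\<gamma>. ennreal ((norm (fourier_L1 (\<phi> n) \<gamma> - F \<gamma>))\<^sup>2) \<partial>lebesgue) \<longlonglongrightarrow> 0"
    by (auto simp: is_fourier_def)
  from G obtain \<psi> where \<psi>: "\<And>n. integrable lebesgue (\<psi> n)"
    "(\<lambda>n. \<integral>\<^sup>+x. ennreal ((norm (\<psi> n x - f x))\<^sup>2) \<partial>lebesgue) \<longlonglongrightarrow> 0"
    "(\<lambda>n. \<integral>\<^sup>+\<gamma>. ennreal ((norm (fourier_L1 (\<psi> n) \<gamma> - G \<gamma>))\<^sup>2) \<partial>lebesgue) \<longlonglongrightarrow> 0"
    by (auto simp: is_fourier_def)
  have [measurable]: "f \<in> borel_measurable lebesgue" "F \<in> borel_measurable lebesgue" "G \<in> borel_measurable lebesgue"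
    using f F G by (auto simp: is_fourier_def L2_def)
  have [measurable]: "\<phi> n \<in> borel_measurable lebesgue" "\<psi> n \<in> borel_measurable lebesgue"
    "fourier_L1 (\<phi> n) \<in> borel_measurable lebesgue" "fourier_L1 (\<psi> n) \<in> borel_measurable lebesgue" for n
    using \<phi>(1) \<psi>(1)
    by (auto intro!: measurable_completion borel_measurable_fourier_L1_lebesgue dest: borel_measurable_integrable)
  define A where "A = (\<lambda>n. \<integral>\<^sup>+x. ennreal ((norm (\<phi> n x - f x))\<^sup>2) \<partial>lebesgue)"
  define B where "B = (\<lambda>n. \<integral>\<^sup>+x. ennreal ((norm (\<psi> n x - f x))\<^sup>2) \<partial>lebesgue)"
  define A' where "A' = (\<lambda>n. \<integral>\<^sup>+\<gamma>. ennreal ((norm (fourier_L1 (\<phi> n) \<gamma> - F \<gamma>))\<^sup>2) \<partial>lebesgue)"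
  define B' where "B' = (\<lambda>n. \<integral>\<^sup>+\<gamma>. ennreal ((norm (fourier_L1 (\<psi> n) \<gamma> - G \<gamma>))\<^sup>2) \<partial>lebesgue)"
  define c where "c = ennreal (2 * fejer_const)"
  \<comment> \<open>The path runs from \<open>F\<close> through the transforms of
    \<open>\<phi> n\<close> and \<open>\<psi> n\<close> to \<open>G\<close>. The middle distance is
    controlled by the distances of \<open>\<phi> n\<close> and \<open>\<psi> n\<close> to
    \<open>f\<close>.\<close>
  have bound: "(\<integral>\<^sup>+\<gamma>. ennreal ((norm (F \<gamma> - G \<gamma>))\<^sup>2) \<partial>lebesgue)
      \<le> 2 * A' n + 2 * (2 * (c * (2 * A n + 2 * B n)) + 2 * B' n)" for n
  proof -
    have "(\<integral>\<^sup>+x. ennreal ((norm (\<phi> n x - \<psi> n x))\<^sup>2) \<partial>lebesgue) \<le> 2 * A n + 2 * B n"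
      using nn_integral_norm_add_square_le[of "\<lambda>x. \<phi> n x - f x" lebesgue "\<lambda>x. f x - \<psi> n x"]
      by (simp add: A_def B_def norm_minus_commute)
    then have "c * (\<integral>\<^sup>+x. ennreal ((norm (\<phi> n x - \<psi> n x))\<^sup>2) \<partial>lebesgue) \<le> c * (2 * A n + 2 * B n)"
      by (intro mult_left_mono) auto
    moreover have "(\<integral>\<^sup>+\<gamma>. ennreal ((norm (fourier_L1 (\<phi> n) \<gamma> - fourier_L1 (\<psi> n) \<gamma>))\<^sup>2) \<partial>lebesgue)
        \<le> c * (\<integral>\<^sup>+x. ennreal ((norm (\<phi> n x - \<psi> n x))\<^sup>2) \<partial>lebesgue)"
      using Plancherel_bound_lebesgue[of "\<lambda>x. \<phi> n x - \<psi> n x"] \<phi>(1)[of n] \<psi>(1)[of n]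
      by (simp add: fourier_L1_diff c_def)
    ultimately have "(\<integral>\<^sup>+\<gamma>. ennreal ((norm (fourier_L1 (\<phi> n) \<gamma> - fourier_L1 (\<psi> n) \<gamma>))\<^sup>2) \<partial>lebesgue)
        \<le> c * (2 * A n + 2 * B n)"
      by (rule order_trans[rotated])
    then have "2 * (\<integral>\<^sup>+\<gamma>. ennreal ((norm (fourier_L1 (\<phi> n) \<gamma> - fourier_L1 (\<psi> n) \<gamma>))\<^sup>2) \<partial>lebesgue) + 2 * B' n
        \<le> 2 * (c * (2 * A n + 2 * B n)) + 2 * B' n"
      by (intro add_right_mono mult_left_mono) auto
    moreover have "(\<integral>\<^sup>+\<gamma>. ennreal ((norm (fourier_L1 (\<phi> n) \<gamma> - G \<gamma>))\<^sup>2) \<partial>lebesgue)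
        \<le> 2 * (\<integral>\<^sup>+\<gamma>. ennreal ((norm (fourier_L1 (\<phi> n) \<gamma> - fourier_L1 (\<psi> n) \<gamma>))\<^sup>2) \<partial>lebesgue) + 2 * B' n"
      using nn_integral_norm_add_square_le[of "\<lambda>\<gamma>. fourier_L1 (\<phi> n) \<gamma> - fourier_L1 (\<psi> n) \<gamma>" lebesgue
          "\<lambda>\<gamma>. fourier_L1 (\<psi> n) \<gamma> - G \<gamma>"]
      by (simp add: B'_def)
    ultimately have "(\<integral>\<^sup>+\<gamma>. ennreal ((norm (fourier_L1 (\<phi> n) \<gamma> - G \<gamma>))\<^sup>2) \<partial>lebesgue)
        \<le> 2 * (c * (2 * A n + 2 * B n)) + 2 * B' n"
      by (rule order_trans[rotated])
    then have "2 * A' n + 2 * (\<integral>\<^sup>+\<gamma>. ennreal ((norm (fourier_L1 (\<phi> n) \<gamma> - G \<gamma>))\<^sup>2) \<partial>lebesgue)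
        \<le> 2 * A' n + 2 * (2 * (c * (2 * A n + 2 * B n)) + 2 * B' n)"
      by (intro add_left_mono mult_left_mono) auto
    moreover have "(\<integral>\<^sup>+\<gamma>. ennreal ((norm (F \<gamma> - G \<gamma>))\<^sup>2) \<partial>lebesgue)
        \<le> 2 * A' n + 2 * (\<integral>\<^sup>+\<gamma>. ennreal ((norm (fourier_L1 (\<phi> n) \<gamma> - G \<gamma>))\<^sup>2) \<partial>lebesgue)"
      using nn_integral_norm_add_square_le[of "\<lambda>\<gamma>. F \<gamma> - fourier_L1 (\<phi> n) \<gamma>" lebesgue
          "\<lambda>\<gamma>. fourier_L1 (\<phi> n) \<gamma> - G \<gamma>"]
      by (simp add: A'_def norm_minus_commute)
    ultimately show ?thesis
      by (rule order_trans[rotated])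
  qed
  have "(\<lambda>n. 2 * A' n + 2 * (2 * (c * (2 * A n + 2 * B n)) + 2 * B' n))
      \<longlonglongrightarrow> 2 * 0 + 2 * (2 * (c * (2 * 0 + 2 * 0)) + 2 * 0)"
    using \<phi>(2,3) \<psi>(2,3) unfolding A_def[symmetric] B_def[symmetric] A'_def[symmetric] B'_def[symmetric]
    by (intro tendsto_add ennreal_tendsto_cmult) (auto simp: c_def)
  then have "(\<integral>\<^sup>+\<gamma>. ennreal ((norm (F \<gamma> - G \<gamma>))\<^sup>2) \<partial>lebesgue) \<le> 0"
    using bound by (intro LIMSEQ_le_const[where X = "\<lambda>n. 2 * A' n + _ n"]) auto
  then have "AE \<gamma> in lebesgue. ennreal ((norm (F \<gamma> - G \<gamma>))\<^sup>2) = 0"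
    by (subst (asm) le_zero_eq, subst (asm) nn_integral_0_iff_AE) auto
  then show ?thesis by (auto elim!: eventually_mono)
qed

text \<open>On a bounded interval square integrability implies integrability, because a norm is at
  most its square plus 1.\<close>

lemma integrable_indicator_truncation:
  fixes f :: "real \<Rightarrow> complex"
  assumes [measurable]: "f \<in> borel_measurable borel"
    and fin: "(\<integral>\<^sup>+x. ennreal ((norm (f x))\<^sup>2) \<partial>lborel) < \<infinity>"
  shows "integrable lborel (\<lambda>x. f x * indicator {- N..N} x)"
proof (rule Bochner_Integration.integrable_bound)
  have "integrable lborel (\<lambda>x. (norm (f x))\<^sup>2)"
    using fin by (simp add: integrable_iff_bounded)
  then show "integrable lborel (\<lambda>x. (norm (f x))\<^sup>2 + indicator {- N..N} x)"
    by (intro Bochner_Integration.integrable_add integrable_real_indicator) (auto simp: emeasure_lborel_Icc_eq)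
  have "norm (f x) \<le> (norm (f x))\<^sup>2 + 1" for x
  proof -
    have "2 * norm (f x) \<le> (norm (f x))\<^sup>2 + 1"
      using sum_squares_bound[of "norm (f x)" 1] by simp
    with norm_ge_zero[of "f x"] show ?thesis by linarith
  qed
  then show "AE x in lborel. norm (f x * indicator {- N..N} x) \<le> norm ((norm (f x))\<^sup>2 + indicator {- N..N} x)"
    by (intro AE_I2) (auto simp: indicator_def)
qed measurable

text \<open>Dominated convergence: at each point the integrand is eventually 0, and it stays below
  the integrable square of the norm.\<close>

lemma tail_square_integral_small:
  fixes f :: "real \<Rightarrow> complex"
  assumes [measurable]: "f \<in> borel_measurable borel"
    and fin: "(\<integral>\<^sup>+x. ennreal ((norm (f x))\<^sup>2) \<partial>lborel) < \<infinity>" and "0 < e"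
  shows "\<exists>N0::nat. \<forall>N\<ge>N0. (\<integral>\<^sup>+x. ennreal ((norm (f x))\<^sup>2) * indicator (- {- real N..real N}) x \<partial>lborel) \<le> ennreal e"
proof -
  have "(\<lambda>N. \<integral>\<^sup>+x. ennreal ((norm (f x))\<^sup>2) * indicator (- {- real N..real N}) x \<partial>lborel)
      \<longlonglongrightarrow> (\<integral>\<^sup>+x. 0 \<partial>(lborel :: real measure))"
  proof (rule nn_integral_dominated_convergence[where w = "\<lambda>x. ennreal ((norm (f x))\<^sup>2)"])
    show "AE x in lborel. (\<lambda>N. ennreal ((norm (f x))\<^sup>2) * indicator (- {- real N..real N}) x) \<longlonglongrightarrow> 0"
    proof (rule AE_I2)
      fix x :: real
      obtain n :: nat where n: "\<bar>x\<bar> \<le> real n"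
        using real_arch_simple by blast
      have "ennreal ((norm (f x))\<^sup>2) * indicator (- {- real N..real N}) x = 0" if "n \<le> N" for N
        using n that by (simp add: indicator_def) linarith
      then show "(\<lambda>N. ennreal ((norm (f x))\<^sup>2) * indicator (- {- real N..real N}) x) \<longlonglongrightarrow> 0"
        by (intro tendsto_eventually eventually_sequentiallyI[of n])
    qed
  qed (use fin in \<open>auto simp: indicator_def\<close>)
  then have "\<forall>\<^sub>F N in sequentially.
      (\<integral>\<^sup>+x. ennreal ((norm (f x))\<^sup>2) * indicator (- {- real N..real N}) x \<partial>lborel) < ennreal e"
    using \<open>0 < e\<close> by (intro order_tendstoD(2)) auto
  then show ?thesis
    by (auto simp: eventually_sequentially intro: less_imp_le)
qed

text \<open>Truncations to growing intervals are integrable and approximate the function in L2. With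
  tails of size \<open>1 / 4 ^ n\<close>, the Plancherel bound gives their transforms the Cauchy
  rate that \<open>Riesz_Fischer\<close> requires.\<close>

lemma is_fourier_exists:
  assumes f: "f \<in> L2"
  shows "\<exists>F. is_fourier f F"
proof -
  obtain g where g [measurable]: "g \<in> borel_measurable borel" and fg: "AE x in lebesgue. f x = g x"
    using f lebesgue_ex_borel_complex unfolding L2_def by blast
  have "(\<integral>\<^sup>+x. ennreal ((norm (f x))\<^sup>2) \<partial>lebesgue) = (\<integral>\<^sup>+x. ennreal ((norm (g x))\<^sup>2) \<partial>lebesgue)"
    using fg by (intro nn_integral_cong_AE) auto
  then have fin: "(\<integral>\<^sup>+x. ennreal ((norm (g x))\<^sup>2) \<partial>lborel) < \<infinity>"
    using f by (simp add: L2_iff nn_integral_completion)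
  define tail where "tail N = (\<integral>\<^sup>+x. ennreal ((norm (g x))\<^sup>2) * indicator (- {- real N..real N}) x \<partial>lborel)" for N :: nat
  have "\<forall>n. \<exists>N0. \<forall>N\<ge>N0. tail N \<le> ennreal (1 / 4 ^ n)"
    unfolding tail_def using fin by (intro allI tail_square_integral_small) auto
  then obtain M where M: "\<And>n N. M n \<le> N \<Longrightarrow> tail N \<le> ennreal (1 / 4 ^ n)"
    by metis
  \<comment> \<open>Summing the radii makes them monotone in \<open>n\<close> while keeping each at
    least \<open>M n\<close>.\<close>
  define N where "N n = (\<Sum>k\<le>n. M k)" for n
  have tail_N: "tail (N n) \<le> ennreal (1 / 4 ^ n)" for n
    unfolding N_def by (intro M member_le_sum) auto
  have N_mono: "N n \<le> N m" if "n \<le> m" for n m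
    unfolding N_def using that by (intro sum_mono2) auto
  define \<phi> where "\<phi> n x = g x * indicator {- real (N n)..real (N n)} x" for n x
  have \<phi>_meas [measurable]: "\<phi> n \<in> borel_measurable borel" for n
    unfolding \<phi>_def by measurable
  have \<phi>_int: "integrable lborel (\<phi> n)" for n
    unfolding \<phi>_def by (rule integrable_indicator_truncation[OF g fin])
  then have \<phi>_int': "integrable lebesgue (\<phi> n)" for n
    by (simp add: integrable_completion)
  \<comment> \<open>Each error estimated below, between two truncations or between a truncation and
    \<open>g\<close>, vanishes on the smaller interval and is at most \<open>norm (g x)\<close>
    outside it.\<close>
  have le_tail: "(\<integral>\<^sup>+x. ennreal ((norm (h x))\<^sup>2) \<partial>lborel) \<le> ennreal (1 / 4 ^ n)"
    if "\<And>x. norm (h x) \<le> norm (g x) * indicator (- {- real (N n)..real (N n)}) x" for h :: "real \<Rightarrow> complex" and n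
  proof -
    have "(\<integral>\<^sup>+x. ennreal ((norm (h x))\<^sup>2) \<partial>lborel) \<le> tail (N n)"
      unfolding tail_def
    proof (rule nn_integral_mono)
      fix x
      show "ennreal ((norm (h x))\<^sup>2) \<le> ennreal ((norm (g x))\<^sup>2) * indicator (- {- real (N n)..real (N n)}) x"
        using that[of x] by (auto simp: indicator_def split: if_splits intro!: ennreal_leI power_mono)
    qed
    with tail_N[of n] show ?thesis by (rule order_trans[rotated])
  qed
  have \<phi>_lim: "(\<integral>\<^sup>+x. ennreal ((norm (\<phi> n x - g x))\<^sup>2) \<partial>lborel) \<le> ennreal (1 / 4 ^ n)" for n
    by (rule le_tail) (auto simp: \<phi>_def indicator_def)
  have "\<phi> n \<in> L2" for n
  proof -
    have "(\<integral>\<^sup>+x. ennreal ((norm (\<phi> n x))\<^sup>2) \<partial>lborel) \<le> (\<integral>\<^sup>+x. ennreal ((norm (g x))\<^sup>2) \<partial>lborel)"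
      by (intro nn_integral_mono) (auto simp: \<phi>_def indicator_def)
    with fin show ?thesis
      by (auto simp: L2_iff nn_integral_completion intro!: measurable_completion)
  qed
  note \<phi>_L2 = this
  have F_meas [measurable]: "fourier_L1 (\<phi> n) \<in> borel_measurable borel" for n
    by (rule borel_measurable_fourier_L1) simp
  have cauchy: "(\<integral>\<^sup>+\<gamma>. ennreal ((norm (fourier_L1 (\<phi> m) \<gamma> - fourier_L1 (\<phi> n) \<gamma>))\<^sup>2) \<partial>lborel)
      \<le> ennreal (2 * fejer_const / 4 ^ n)" if "n \<le> m" for n m
  proof -
    have "(\<integral>\<^sup>+\<gamma>. ennreal ((norm (fourier_L1 (\<phi> m) \<gamma> - fourier_L1 (\<phi> n) \<gamma>))\<^sup>2) \<partial>lborel)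
        \<le> ennreal (2 * fejer_const) * (\<integral>\<^sup>+x. ennreal ((norm (\<phi> m x - \<phi> n x))\<^sup>2) \<partial>lborel)"
      using Plancherel_bound[of "\<lambda>x. \<phi> m x - \<phi> n x"] \<phi>_int \<phi>_int' by (simp add: fourier_L1_diff)
    also have "\<dots> \<le> ennreal (2 * fejer_const) * ennreal (1 / 4 ^ n)"
      using N_mono[OF that] by (intro mult_left_mono le_tail) (auto simp: \<phi>_def indicator_def)
    finally show ?thesis
      using fejer_const_pos by (simp add: ennreal_mult[symmetric])
  qed
  obtain F where F [measurable]: "F \<in> borel_measurable lborel"
    and F_lim: "\<And>n. (\<integral>\<^sup>+\<gamma>. ennreal ((norm (fourier_L1 (\<phi> n) \<gamma> - F \<gamma>))\<^sup>2) \<partial>lborel)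
      \<le> ennreal (2 * fejer_const / 4 ^ n)"
    by (rule Riesz_Fischer[of "\<lambda>n. fourier_L1 (\<phi> n)" lborel "2 * fejer_const"])
       (use fejer_const_pos cauchy in auto)
  \<comment> \<open>\<open>F\<close> is at finite distance from the first transform, which itself
    has finite norm.\<close>
  have "(\<integral>\<^sup>+\<gamma>. ennreal ((norm (F \<gamma>))\<^sup>2) \<partial>lborel)
      \<le> 2 * (\<integral>\<^sup>+\<gamma>. ennreal ((norm (fourier_L1 (\<phi> 0) \<gamma>))\<^sup>2) \<partial>lborel)
        + 2 * (\<integral>\<^sup>+\<gamma>. ennreal ((norm (fourier_L1 (\<phi> 0) \<gamma> - F \<gamma>))\<^sup>2) \<partial>lborel)"
    using nn_integral_norm_add_square_le[of "fourier_L1 (\<phi> 0)" lborel "\<lambda>\<gamma>. F \<gamma> - fourier_L1 (\<phi> 0) \<gamma>"]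
    by (simp add: norm_minus_commute)
  also have "\<dots> < \<infinity>"
  proof -
    have "(\<integral>\<^sup>+\<gamma>. ennreal ((norm (fourier_L1 (\<phi> 0) \<gamma>))\<^sup>2) \<partial>lborel) < \<infinity>"
      using is_fourier_L1[OF \<phi>_int' \<phi>_L2, of 0] by (auto simp: is_fourier_def L2_iff nn_integral_completion)
    moreover have "(\<integral>\<^sup>+\<gamma>. ennreal ((norm (fourier_L1 (\<phi> 0) \<gamma> - F \<gamma>))\<^sup>2) \<partial>lborel) < \<infinity>"
      using F_lim[of 0] by (rule le_less_trans) simp
    ultimately show ?thesis by (simp add: ennreal_mult_less_top)
  qed
  finally have F_L2: "F \<in> L2"
    using F by (auto simp: L2_iff nn_integral_completion intro!: measurable_completion)
  have squeeze: "u \<longlonglongrightarrow> 0" if "\<And>n. u n \<le> ennreal (c / 4 ^ n)" for u :: "nat \<Rightarrow> ennreal" and c :: real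
  proof (rule tendsto_sandwich[of "\<lambda>_. 0"])
    have "(\<lambda>n. c / 4 ^ n) \<longlonglongrightarrow> 0" by real_asymp
    then show "(\<lambda>n. ennreal (c / 4 ^ n)) \<longlonglongrightarrow> 0"
      using tendsto_ennrealI by fastforce
  qed (use that in auto)
  have "is_fourier g F"
    unfolding is_fourier_def
    by (intro conjI F_L2 exI[of _ \<phi>] squeeze allI \<phi>_int' \<phi>_L2)
       (auto simp: nn_integral_completion intro: \<phi>_lim F_lim)
  then show ?thesis
    using is_fourier_cong_AE[OF fg] by blast
qed

lemma is_fourier_fourier: "f \<in> L2 \<Longrightarrow> is_fourier f (fourier f)"
  unfolding fourier_def by (rule someI_ex[OF is_fourier_exists])

lemma fourier_in_L2: "f \<in> L2 \<Longrightarrow> fourier f \<in> L2"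
  using is_fourier_fourier by (simp add: is_fourier_def)

text \<open>\<open>fourier\<close> picks an arbitrary transform, so uniqueness identifies it with
  the defining integral only up to a null set.\<close>

lemma fourier_eq_fourier_L1_AE:
  assumes "integrable lebesgue f" "f \<in> L2"
  shows "AE \<gamma> in lebesgue. fourier f \<gamma> = fourier_L1 f \<gamma>"
  using assms by (intro is_fourier_unique_AE[of f] is_fourier_fourier is_fourier_L1)

subsection \<open>Functions with prescribed transform support\<close>

text \<open>Modulation moves the tent of the Fejer function to the centre \<open>p\<close>; the
  factor \<open>2 * pi\<close> makes \<open>r\<close> its half-width in the frequency normalisation
  of \<open>fourier_L1\<close>.\<close>

definition atom :: "real \<Rightarrow> real \<Rightarrow> real \<Rightarrow> complex" where
  "atom p r x = of_real (fejer (2 * pi * r) x) * cis (2 * pi * p * x)"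

lemma norm_atom: "norm (atom p r x) = fejer (2 * pi * r) x"
  by (simp add: atom_def norm_mult fejer_nonneg)

lemma borel_measurable_atom [measurable]: "atom p r \<in> borel_measurable borel"
  unfolding atom_def[abs_def] cis_conv_exp by measurable

lemma integrable_atom: "integrable lborel (atom p r)"
  unfolding atom_def by (intro integrable_mult_cis) (simp_all add: integrable_fejer)

lemma fourier_L1_atom:
  assumes "0 \<le> r"
  shows "fourier_L1 (atom p r) \<gamma> = of_real (2 * pi * fejer_const * max 0 (r - \<bar>\<gamma> - p\<bar>))"
proof -
  have "cis (2 * pi * p * x) * cis (- 2 * pi * \<gamma> * x) = cis ((2 * pi * (p - \<gamma>)) * x)" for x
    by (simp add: cis_mult algebra_simps)
  then have "fourier_L1 (atom p r) \<gamma>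
      = (LINT x|lborel. of_real (fejer (2 * pi * r) x) * cis ((2 * pi * (p - \<gamma>)) * x))"
    by (simp add: fourier_L1_eq_lborel atom_def mult.assoc)
  also have "\<dots> = of_real (fejer_const * max 0 (2 * pi * r - \<bar>2 * pi * (p - \<gamma>)\<bar>))"
    using assms by (intro integral_fejer_cis) simp
  also have "max 0 (2 * pi * r - \<bar>2 * pi * (p - \<gamma>)\<bar>) = 2 * pi * max 0 (r - \<bar>\<gamma> - p\<bar>)"
  proof -
    have "\<bar>2 * pi * (p - \<gamma>)\<bar> = 2 * pi * \<bar>\<gamma> - p\<bar>"
      by (simp only: abs_mult abs_minus_commute[of p]) simp
    then show ?thesis by (simp only: max_mult_distrib_left right_diff_distrib) simp
  qed
  finally show ?thesis by (simp add: mult_ac)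
qed

text \<open>The boxes of a countable decomposition are enumerated, with repetition if there are
  finitely many; an empty box becomes a ball of radius 0.\<close>

lemma open_real_eq_UN_balls:
  fixes U :: "real set"
  assumes "open U" "U \<noteq> {}"
  obtains p r :: "nat \<Rightarrow> real" where "\<And>n. 0 \<le> r n" "U = (\<Union>n. ball (p n) (r n))"
proof -
  obtain D where D: "countable D" "\<And>X. X \<in> D \<Longrightarrow> \<exists>a b. X = box a b" "\<Union>D = U"
    using open_countable_Union_open_box[OF assms(1)] by metis
  have "D \<noteq> {}" using D(3) assms(2) by auto
  then have range: "range (from_nat_into D) = D"
    by (simp add: D(1))
  have "\<exists>p r. 0 \<le> r \<and> from_nat_into D n = ball p r" for n
  proof -
    obtain a b where ab: "from_nat_into D n = box a b"
      using D(2) from_nat_into[OF \<open>D \<noteq> {}\<close>] by blast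
    show ?thesis
    proof (cases "a < b")
      case True
      then have "box a b = ball ((a + b) / 2) ((b - a) / 2)"
        by (auto simp: dist_real_def field_simps abs_if split: if_splits)
      with ab True show ?thesis
        by (intro exI[of _ "(a + b) / 2"] exI[of _ "(b - a) / 2"]) simp
    next
      case False
      then have "from_nat_into D n = ball 0 0" using ab by (simp add: box_real)
      then show ?thesis by (intro exI[of _ 0]) simp
    qed
  qed
  then obtain p r where pr: "\<And>n. 0 \<le> r n" "\<And>n. from_nat_into D n = ball (p n) (r n)"
    by metis
  moreover have "U = (\<Union>n. ball (p n) (r n))"
    using D(3) range pr(2) by (metis (no_types, lifting) image_cong)
  ultimately show thesis using that by blast
qed

text \<open>Write \<open>U\<close> as a countable union of balls and add one tent per ball with
  positive weights. The sum is positive exactly where some tent is, and a single tent already gives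
  a positive lower bound on an interval.\<close>

lemma exists_L1_L2_with_nonneg_transform:
  fixes U :: "real set"
  assumes "open U" "U \<noteq> {}"
  obtains f F where "integrable lebesgue f" "f \<in> L2" "\<And>\<gamma>. fourier_L1 f \<gamma> = of_real (F \<gamma>)"
    "\<And>\<gamma>. 0 \<le> F \<gamma>" "\<And>\<gamma>. 0 < F \<gamma> \<longleftrightarrow> \<gamma> \<in> U"
    "\<exists>a b \<delta>. a < b \<and> 0 < \<delta> \<and> (\<forall>\<gamma>\<in>{a..b}. \<delta> \<le> F \<gamma>)"
proof -
  obtain p r where r: "\<And>n. 0 \<le> r n" and U: "U = (\<Union>n::nat. ball (p n) (r n))"
    using open_real_eq_UN_balls[OF assms] by metis
  define I where "I n = (LINT x|lborel. norm (atom (p n) (r n) x))" for n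
  \<comment> \<open>The denominator dominates both the L1 norm and the supremum bound of the atom,
    so the series converges geometrically in L1 and uniformly. The summand 1 keeps the denominator
    positive.\<close>
  define a where "a n = (1 / 2) ^ n / (1 + I n + (2 * pi * r n)\<^sup>2 / 2)" for n
  define f where "f x = (\<Sum>n. of_real (a n) * atom (p n) (r n) x)" for x
  define F where "F \<gamma> = (\<Sum>n. a n * (2 * pi * fejer_const * max 0 (r n - \<bar>\<gamma> - p n\<bar>)))" for \<gamma>
  have I_nonneg: "0 \<le> I n" for n by (simp add: I_def)
  have a_pos: "0 < a n" for n
    using I_nonneg[of n] by (auto simp: a_def intro!: divide_pos_pos add_pos_nonneg)
  have a_le: "a n * t \<le> (1 / 2) ^ n" if "t \<le> 1 + I n + (2 * pi * r n)\<^sup>2 / 2" for n t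
  proof -
    have "0 < 1 + I n + (2 * pi * r n)\<^sup>2 / 2"
      using I_nonneg[of n] by (intro add_pos_nonneg) auto
    then show ?thesis using that by (simp add: a_def divide_simps)
  qed
  have norm_le: "norm (of_real (a n) * atom (p n) (r n) x) \<le> (1 / 2) ^ n" for n x
    using a_le[of "fejer (2 * pi * r n) x" n] fejer_le[of "2 * pi * r n" x] I_nonneg[of n] a_pos[of n]
    by (simp add: norm_mult norm_atom)
  have summable_f: "summable (\<lambda>n. norm (of_real (a n) * atom (p n) (r n) x))" for x
    by (rule summable_comparison_test'[of "\<lambda>n. (1 / 2) ^ n" 0]) (use norm_le in auto)
  have summable_int: "summable (\<lambda>n. a n * I n)"
    by (rule summable_comparison_test'[of "\<lambda>n. (1 / 2) ^ n" 0])
       (use a_le a_pos I_nonneg in \<open>auto simp: abs_mult less_imp_le\<close>)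
  have f_bound: "norm (f x) \<le> 2" for x
  proof -
    have "norm (f x) \<le> (\<Sum>n. norm (of_real (a n) * atom (p n) (r n) x))"
      unfolding f_def by (rule summable_norm[OF summable_f])
    also have "\<dots> \<le> (\<Sum>n. (1 / 2) ^ n)"
      by (intro suminf_le norm_le summable_f) simp
    finally show ?thesis by (simp add: suminf_geometric)
  qed
  have f_int: "integrable lborel f"
    unfolding f_def
  proof (rule integrable_suminf)
    show "integrable lborel (\<lambda>x. of_real (a n) * atom (p n) (r n) x)" for n
      by (intro integrable_mult_right integrable_atom)
    show "AE x in lborel. summable (\<lambda>n. norm (of_real (a n) * atom (p n) (r n) x))"
      by (intro AE_I2 summable_f)
    show "summable (\<lambda>n. LINT x|lborel. norm (of_real (a n) * atom (p n) (r n) x))"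
      using summable_int a_pos by (simp add: norm_mult I_def less_imp_le)
  qed
  then have [measurable]: "f \<in> borel_measurable borel"
    by (auto dest: borel_measurable_integrable)
  have f_int': "integrable lebesgue f"
    using f_int by (simp add: integrable_completion)
  have f_L2: "f \<in> L2"
    unfolding L2_def
  proof (intro CollectI conjI)
    show "f \<in> borel_measurable lebesgue"
      by (rule measurable_completion) simp
    then have [measurable]: "(\<lambda>x. (norm (f x))\<^sup>2) \<in> borel_measurable lebesgue" by measurable
    \<comment> \<open>A bounded integrable function is square integrable; the bound 2 is the sum of
      the geometric series.\<close>
    have "(norm (f x))\<^sup>2 \<le> 2 * norm (f x)" for x
      using mult_right_mono[OF f_bound[of x] norm_ge_zero[of "f x"]] by (simp add: power2_eq_square)
    then show "integrable lebesgue (\<lambda>x. (norm (f x))\<^sup>2)"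
      by (intro Bochner_Integration.integrable_bound[OF integrable_mult_right[OF integrable_norm[OF f_int'], of 2]]) auto
  qed
  \<comment> \<open>Summability of the L1 norms allows the transform to be taken term by
    term.\<close>
  have sums: "(\<lambda>n. of_real (a n * (2 * pi * fejer_const * max 0 (r n - \<bar>\<gamma> - p n\<bar>)))) sums fourier_L1 f \<gamma>" for \<gamma>
  proof -
    have "(\<lambda>n. LINT x|lborel. of_real (a n) * atom (p n) (r n) x * cis (- 2 * pi * \<gamma> * x))
        sums (LINT x|lborel. (\<Sum>n. of_real (a n) * atom (p n) (r n) x * cis (- 2 * pi * \<gamma> * x)))"
    proof (rule sums_integral)
      show "integrable lborel (\<lambda>x. of_real (a n) * atom (p n) (r n) x * cis (- 2 * pi * \<gamma> * x))" for n
        by (intro integrable_mult_cis integrable_mult_right integrable_atom) simp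
      show "AE x in lborel. summable (\<lambda>n. norm (of_real (a n) * atom (p n) (r n) x * cis (- 2 * pi * \<gamma> * x)))"
        using summable_f by (intro AE_I2) (simp add: norm_mult)
      show "summable (\<lambda>n. LINT x|lborel. norm (of_real (a n) * atom (p n) (r n) x * cis (- 2 * pi * \<gamma> * x)))"
        using summable_int a_pos by (simp add: norm_mult I_def less_imp_le)
    qed
    moreover have "(\<Sum>n. of_real (a n) * atom (p n) (r n) x * cis (- 2 * pi * \<gamma> * x))
        = f x * cis (- 2 * pi * \<gamma> * x)" for x
      unfolding f_def using summable_norm_cancel[OF summable_f[of x]] by (rule suminf_mult2[symmetric])
    moreover have "(LINT x|lborel. of_real (a n) * atom (p n) (r n) x * cis (- 2 * pi * \<gamma> * x))
        = of_real (a n * (2 * pi * fejer_const * max 0 (r n - \<bar>\<gamma> - p n\<bar>)))" for n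
      using fourier_L1_atom[OF r[of n], of "p n" \<gamma>]
      by (simp add: mult.assoc fourier_L1_eq_lborel)
    ultimately show ?thesis
      by (simp add: fourier_L1_eq_lborel)
  qed
  have term_nonneg: "0 \<le> a n * (2 * pi * fejer_const * max 0 (r n - \<bar>\<gamma> - p n\<bar>))" for n \<gamma>
    using a_pos[of n] fejer_const_pos by simp
  have summable_F: "summable (\<lambda>n. a n * (2 * pi * fejer_const * max 0 (r n - \<bar>\<gamma> - p n\<bar>)))" for \<gamma>
    using sums_summable[OF sums[of \<gamma>]] by (simp only: summable_complex_of_real)
  have f_F: "fourier_L1 f \<gamma> = of_real (F \<gamma>)" for \<gamma>
    using sums_unique2[OF sums[of \<gamma>]] sums_of_real[OF summable_sums[OF summable_F[of \<gamma>]]] F_def by metis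
  have term_le: "a n * (2 * pi * fejer_const * max 0 (r n - \<bar>\<gamma> - p n\<bar>)) \<le> F \<gamma>" for n \<gamma>
    unfolding F_def
    using sum_le_suminf[OF summable_F, of "{n}" \<gamma>] term_nonneg by simp
  have F_nonneg: "0 \<le> F \<gamma>" for \<gamma>
    unfolding F_def by (intro suminf_nonneg summable_F term_nonneg)
  have F_pos: "0 < F \<gamma> \<longleftrightarrow> \<gamma> \<in> U" for \<gamma>
  proof
    assume "\<gamma> \<in> U"
    then obtain n where "\<bar>\<gamma> - p n\<bar> < r n" by (auto simp: U dist_real_def abs_minus_commute)
    then have "0 < a n * (2 * pi * fejer_const * max 0 (r n - \<bar>\<gamma> - p n\<bar>))"
      using a_pos[of n] fejer_const_pos by simp
    then show "0 < F \<gamma>" by (rule less_le_trans[OF _ term_le])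
  next
    assume "0 < F \<gamma>"
    then obtain n where "0 < a n * (2 * pi * fejer_const * max 0 (r n - \<bar>\<gamma> - p n\<bar>))"
      unfolding F_def using suminf_pos_iff[OF summable_F[of \<gamma>] term_nonneg] by auto
    then have "\<bar>\<gamma> - p n\<bar> < r n"
      using a_pos[of n] fejer_const_pos by (auto simp: zero_less_mult_iff max_def split: if_splits)
    then show "\<gamma> \<in> U" by (auto simp: U dist_real_def abs_minus_commute)
  qed
  obtain n where n: "0 < r n"
    using assms(2) unfolding U by (auto simp: not_less[symmetric])
  \<comment> \<open>On the inner half of a nonempty ball its tent is at least half the radius,
    before weighting.\<close>
  have "a n * (2 * pi * fejer_const * (r n / 2)) \<le> F \<gamma>" if "\<gamma> \<in> {p n - r n / 2..p n + r n / 2}" for \<gamma>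
  proof -
    have "\<bar>\<gamma> - p n\<bar> \<le> r n / 2" using that unfolding abs_le_iff atLeastAtMost_iff by linarith
    then have "r n / 2 \<le> max 0 (r n - \<bar>\<gamma> - p n\<bar>)" by linarith
    then have "a n * (2 * pi * fejer_const * (r n / 2)) \<le> a n * (2 * pi * fejer_const * max 0 (r n - \<bar>\<gamma> - p n\<bar>))"
      using a_pos[of n] fejer_const_pos by (intro mult_left_mono) auto
    also note term_le
    finally show ?thesis .
  qed
  moreover have "0 < a n * (2 * pi * fejer_const * (r n / 2))"
    using n a_pos[of n] fejer_const_pos by simp
  ultimately have "\<exists>a b \<delta>. a < b \<and> 0 < \<delta> \<and> (\<forall>\<gamma>\<in>{a..b}. \<delta> \<le> F \<gamma>)"
    using n by (intro exI[of _ "p n - r n / 2"] exI[of _ "p n + r n / 2"]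
        exI[of _ "a n * (2 * pi * fejer_const * (r n / 2))"]) auto
  with that f_int' f_L2 f_F F_nonneg F_pos show thesis by blast
qed

section \<open>Essential supports\<close>

lemma ess_supp_cong_AE:
  assumes "AE x in lebesgue. F x = G x"
  shows "ess_supp F = ess_supp G"
proof -
  have *: "AE x in lebesgue. x \<in> U \<longrightarrow> G x = 0"
    if "AE x in lebesgue. F x = G x" "AE x in lebesgue. x \<in> U \<longrightarrow> F x = 0" for U and F G :: "real \<Rightarrow> complex"
    using that by eventually_elim auto
  have "AE x in lebesgue. G x = F x"
    using assms by eventually_elim simp
  with *[OF assms] *[of G F] have "(AE x in lebesgue. x \<in> U \<longrightarrow> F x = 0) \<longleftrightarrow> (AE x in lebesgue. x \<in> U \<longrightarrow> G x = 0)" for U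
    by blast
  then show ?thesis by (simp add: ess_supp_def)
qed

lemma closed_ess_supp: "closed (ess_supp F)"
  unfolding ess_supp_def by (auto intro!: closed_Compl open_Union)

text \<open>The complement of the support is a possibly uncountable union of open sets. By
  Lindelof's theorem countably many of them cover it, and their exceptional null sets add up to a
  null set.\<close>

lemma AE_eq_0_outside_ess_supp: "AE x in lebesgue. x \<notin> ess_supp F \<longrightarrow> F x = 0"
proof -
  define W where "W = {U. open U \<and> (AE x in lebesgue. x \<in> U \<longrightarrow> F x = 0)}"
  obtain W' where W': "W' \<subseteq> W" "countable W'" "\<Union>W' = \<Union>W"
    using Lindelof[of W] by (auto simp: W_def)
  have "AE x in lebesgue. \<forall>U\<in>W'. x \<in> U \<longrightarrow> F x = 0"
    using W' by (subst AE_ball_countable) (auto simp: W_def)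
  then show ?thesis
    by eventually_elim (use W'(3) in \<open>auto simp: ess_supp_def W_def\<close>)
qed

text \<open>An open neighbourhood of a point of \<open>U\<close> meets \<open>U\<close> in a
  nonempty open set, which has positive measure, so \<open>F\<close> cannot vanish almost everywhere
  on it. Off the closure of \<open>U\<close>, which is an open set, \<open>F\<close> is 0.\<close>

lemma ess_supp_between:
  assumes U: "open U" and F: "\<And>x. F x \<noteq> 0 \<longleftrightarrow> x \<in> U"
  shows "U \<subseteq> ess_supp F" "ess_supp F \<subseteq> closure U"
proof -
  show "U \<subseteq> ess_supp F"
  proof
    fix x
    assume "x \<in> U"
    show "x \<in> ess_supp F"
    proof (rule ccontr)
      assume "x \<notin> ess_supp F"
      then obtain V where V: "open V" "x \<in> V" "AE y in lebesgue. y \<in> V \<longrightarrow> F y = 0"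
        by (auto simp: ess_supp_def)
      from V(3) have "AE y in lebesgue. y \<notin> U \<inter> V"
        by eventually_elim (use F in auto)
      moreover have op: "open (U \<inter> V)" using U V(1) by auto
      ultimately have "emeasure lebesgue (U \<inter> V) = 0"
        by (subst (asm) AE_iff_measurable[of "U \<inter> V"]) auto
      then have "emeasure lborel (U \<inter> V) = 0"
        using op by simp
      then have "U \<inter> V = {}"
        using open_not_negligible[OF op] op by (auto simp: negligible_iff_null_sets null_sets_def)
      with \<open>x \<in> U\<close> V(2) show False by auto
    qed
  qed
  have "open (- closure U)" "AE x in lebesgue. x \<in> - closure U \<longrightarrow> F x = 0"
    using F closure_subset[of U] by (auto intro!: AE_I2)
  then show "ess_supp F \<subseteq> closure U"
    unfolding ess_supp_def by blast
qed

subsection \<open>The local integrability sum\<close>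

text \<open>Turns the unordered sums of \<open>LIC_sum\<close> into integrals, so that they can be
  exchanged with the integral over the frequency.\<close>

lemma infsum_eq_nn_integral_count_space:
  fixes f :: "'a \<Rightarrow> ennreal"
  assumes "countable A"
  shows "infsum f A = (\<integral>\<^sup>+x. f x \<partial>count_space A)"
proof (cases "finite A")
  case True
  then show ?thesis by (simp add: nn_integral_count_space_finite)
next
  case False
  have bij: "bij_betw (from_nat_into A) UNIV A"
    using bij_betw_from_nat_into[OF assms False] .
  have "infsum f A = infsum (\<lambda>n. f (from_nat_into A n)) UNIV"
    using infsum_reindex_bij_betw[OF bij, of f] by simp
  also have "\<dots> = (\<Sum>n. f (from_nat_into A n))"
  proof -
    have "((\<lambda>n. f (from_nat_into A n)) has_sum infsum (\<lambda>n. f (from_nat_into A n)) UNIV) UNIV"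
      by (intro has_sum_infsum nonneg_summable_on_complete) simp
    then show ?thesis
      by (intro sums_unique has_sum_imp_sums)
  qed
  also have "\<dots> = (\<integral>\<^sup>+x. f x \<partial>count_space A)"
    using nn_integral_bij_count_space[OF bij, of f] by (simp add: nn_integral_count_space_nat)
  finally show ?thesis .
qed

text \<open>The sum is the supremum of its finite partial sums, and a countable set has only
  countably many finite subsets.\<close>

lemma borel_measurable_nn_integral_count_space:
  fixes f :: "'i \<Rightarrow> 'a \<Rightarrow> ennreal"
  assumes I: "countable I" and f: "\<And>i. i \<in> I \<Longrightarrow> f i \<in> borel_measurable M"
  shows "(\<lambda>x. \<integral>\<^sup>+i. f i x \<partial>count_space I) \<in> borel_measurable M"
proof -
  have "(\<lambda>x. SUP F\<in>{F. finite F \<and> F \<subseteq> I}. \<Sum>i\<in>F. f i x) \<in> borel_measurable M"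
  proof (rule borel_measurable_SUP)
    show "countable {F. finite F \<and> F \<subseteq> I}"
      using I by (rule countable_Collect_finite_subset)
    show "(\<lambda>x. \<Sum>i\<in>F. f i x) \<in> borel_measurable M" if "F \<in> {F. finite F \<and> F \<subseteq> I}" for F
      using that by (intro borel_measurable_sum f) auto
  qed
  then show ?thesis
    by (simp add: nonneg_infsum_complete flip: infsum_eq_nn_integral_count_space[OF I])
qed

section \<open>Counting points of arithmetic progressions in an interval\<close>

lemma nn_integral_arithmetic_progression:
  fixes a b c \<gamma> :: real
  assumes "0 < c"
  shows "(\<integral>\<^sup>+m. indicator {a..b} (\<gamma> + inverse c * real_of_int m) \<partial>count_space UNIV)
    = of_nat (nat (\<lfloor>c * (b - \<gamma>)\<rfloor> - \<lceil>c * (a - \<gamma>)\<rceil> + 1))"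
proof -
  \<comment> \<open>Solving for \<open>m\<close> gives an interval of integers; if it is empty,
    \<open>nat\<close> clips a negative count to 0.\<close>
  have "\<gamma> + inverse c * real_of_int m \<in> {a..b} \<longleftrightarrow> m \<in> {\<lceil>c * (a - \<gamma>)\<rceil>..\<lfloor>c * (b - \<gamma>)\<rfloor>}" for m
    using assms by (auto simp: ceiling_le_iff le_floor_iff field_simps)
  then have "(\<integral>\<^sup>+m. indicator {a..b} (\<gamma> + inverse c * real_of_int m) \<partial>count_space UNIV)
      = (\<integral>\<^sup>+m. indicator {\<lceil>c * (a - \<gamma>)\<rceil>..\<lfloor>c * (b - \<gamma>)\<rfloor>} m \<partial>count_space UNIV)"
    by (simp add: indicator_def)
  also have "\<dots> = emeasure (count_space UNIV) {\<lceil>c * (a - \<gamma>)\<rceil>..\<lfloor>c * (b - \<gamma>)\<rfloor>}"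
    by (rule nn_integral_indicator) simp
  finally show ?thesis
    by (simp add: emeasure_count_space)
qed

text \<open>Rounding both ends inwards only shortens the interval; the 1 comes from counting both
  end points.\<close>

lemma nn_integral_arithmetic_progression_le:
  fixes a b c \<gamma> :: real
  assumes "0 < c" "a \<le> b"
  shows "(\<integral>\<^sup>+m. indicator {a..b} (\<gamma> + inverse c * real_of_int m) \<partial>count_space UNIV) \<le> ennreal (c * (b - a) + 1)"
proof -
  have "\<lfloor>c * (b - \<gamma>)\<rfloor> \<le> c * (b - \<gamma>)" "c * (a - \<gamma>) \<le> \<lceil>c * (a - \<gamma>)\<rceil>"
    by linarith+
  moreover have "0 \<le> c * (b - a)" using assms by simp
  ultimately have "real (nat (\<lfloor>c * (b - \<gamma>)\<rfloor> - \<lceil>c * (a - \<gamma>)\<rceil> + 1)) \<le> c * (b - a) + 1"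
    by (simp add: right_diff_distrib) linarith
  then show ?thesis
    unfolding nn_integral_arithmetic_progression[OF assms(1)] ennreal_of_nat_eq_real_of_nat by (rule ennreal_leI)
qed

text \<open>Each rounding loses at most 1, and counting both end points gains 1 back. For a short
  interval the left side is \<open>ennreal\<close> of a negative number, that is 0.\<close>

lemma nn_integral_arithmetic_progression_ge:
  fixes a b c \<gamma> :: real
  assumes "0 < c"
  shows "ennreal (c * (b - a) - 1) \<le> (\<integral>\<^sup>+m. indicator {a..b} (\<gamma> + inverse c * real_of_int m) \<partial>count_space UNIV)"
proof -
  have "c * (b - \<gamma>) - 1 \<le> \<lfloor>c * (b - \<gamma>)\<rfloor>" "\<lceil>c * (a - \<gamma>)\<rceil> \<le> c * (a - \<gamma>) + 1"
    by linarith+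
  then have "c * (b - a) - 1 \<le> real (nat (\<lfloor>c * (b - \<gamma>)\<rfloor> - \<lceil>c * (a - \<gamma>)\<rceil> + 1))"
    by (simp add: right_diff_distrib) linarith
  then show ?thesis
    unfolding nn_integral_arithmetic_progression[OF assms(1)] ennreal_of_nat_eq_real_of_nat by (rule ennreal_leI)
qed

section \<open>Translations and null sets\<close>

lemma measurable_translation_lebesgue: "(\<lambda>x::real. x + t) \<in> lebesgue \<rightarrow>\<^sub>M lebesgue"
  using lebesgue_affine_measurable[where c = "\<lambda>_::real. 1" and t = t] by (simp add: add.commute)

lemma AE_translation_lebesgue:
  assumes "AE x in lebesgue. P (x::real)"
  shows "AE x in lebesgue. P (x + t)"
proof -
  have "AE x in lborel. P x"
    using assms by (simp add: AE_completion_iff)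
  then obtain N where N: "{x. \<not> P x} \<subseteq> N" "N \<in> null_sets lborel"
    by (auto simp: eventually_ae_filter)
  have "{x. x - (- t) \<in> N} \<in> null_sets lborel"
    using N(2) by (rule null_sets_translation)
  then have "AE x in lborel. P (x + t)"
    by (rule AE_I') (use N(1) in auto)
  then show ?thesis by (rule AE_completion)
qed

text \<open>Only countably many translates occur. This lets bounds on a transform that hold almost
  everywhere be used inside the sum over \<open>m\<close>.\<close>

lemma AE_arithmetic_progressions:
  fixes c :: "'j \<Rightarrow> real"
  assumes "countable J" "AE x in lebesgue. P (x::real)"
  shows "AE x in lebesgue. \<forall>j\<in>J. \<forall>m::int. P (x + inverse (c j) * of_int m)"
  by (simp add: AE_ball_countable[OF assms(1)] AE_all_countable AE_translation_lebesgue[OF assms(2)])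

text \<open>The integrand of the local integrability sum once all sums are moved inside. The inner
  sum is the periodisation, with period \<open>1 / c j\<close>, of the squared modulus of the
  transform of \<open>f\<close>.\<close>

definition LIC_density :: "'j set \<Rightarrow> ('j \<Rightarrow> real) \<Rightarrow> ('j \<Rightarrow> real \<Rightarrow> complex) \<Rightarrow> (real \<Rightarrow> complex) \<Rightarrow> real \<Rightarrow> ennreal" where
  "LIC_density J c g f \<gamma> = (\<integral>\<^sup>+j. ennreal (1 / c j * (norm (fourier (g j) \<gamma>))\<^sup>2) *
     (\<integral>\<^sup>+m. ennreal ((norm (fourier f (\<gamma> + inverse (c j) * of_int m)))\<^sup>2) \<partial>count_space (UNIV :: int set)) \<partial>count_space J)"

context
  fixes J :: "'j set" and c :: "'j \<Rightarrow> real" and g :: "'j \<Rightarrow> real \<Rightarrow> complex"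
  assumes J: "countable J"
    and c_pos: "\<And>j. j \<in> J \<Longrightarrow> c j > 0"
    and g_L2: "\<And>j. j \<in> J \<Longrightarrow> g j \<in> L2"
begin

lemma borel_measurable_fourier_g: "j \<in> J \<Longrightarrow> fourier (g j) \<in> borel_measurable lebesgue"
  using fourier_in_L2[OF g_L2] by (simp add: L2_def)

lemma borel_measurable_fourier_translate:
  assumes "f \<in> L2"
  shows "(\<lambda>\<gamma>. fourier f (\<gamma> + t)) \<in> borel_measurable lebesgue"
  using measurable_compose[OF measurable_translation_lebesgue, of "fourier f" borel t] fourier_in_L2[OF assms]
  by (simp add: L2_def)

lemma borel_measurable_LIC_summand:
  assumes "f \<in> L2" "j \<in> J"
  shows "(\<lambda>\<gamma>. ennreal (1 / c j * (norm (fourier (g j) \<gamma>))\<^sup>2) *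
     (\<integral>\<^sup>+m. ennreal ((norm (fourier f (\<gamma> + inverse (c j) * of_int m)))\<^sup>2) \<partial>count_space (UNIV :: int set)))
    \<in> borel_measurable lebesgue"
proof -
  note [measurable] = borel_measurable_fourier_g[OF assms(2)] borel_measurable_fourier_translate[OF assms(1)]
  show ?thesis
    by (intro borel_measurable_times_ennreal borel_measurable_nn_integral_count_space) measurable
qed

lemma borel_measurable_LIC_density:
  "f \<in> L2 \<Longrightarrow> LIC_density J c g f \<in> borel_measurable lebesgue"
  unfolding LIC_density_def by (intro borel_measurable_nn_integral_count_space J borel_measurable_LIC_summand)

text \<open>All terms are nonnegative, so Tonelli's theorem moves first the sum over
  \<open>m\<close> and then the sum over \<open>j\<close> under the integral.\<close>

lemma LIC_sum_eq_integral_density: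
  assumes f: "f \<in> L2"
  shows "LIC_sum J c g f = (\<integral>\<^sup>+\<gamma>\<in>ess_supp (fourier f). LIC_density J c g f \<gamma> \<partial>lebesgue)"
proof -
  define S where "S = ess_supp (fourier f)"
  have S [measurable]: "S \<in> sets lebesgue"
    using closed_ess_supp[of "fourier f"] by (auto simp: S_def intro: sets_completionI_sets)
  have inner: "(\<Sum>\<^sub>\<infinity>m\<in>(UNIV :: int set). ennreal (1 / c j) *
     (\<integral>\<^sup>+\<gamma>\<in>S. ennreal ((norm (fourier f (\<gamma> + inverse (c j) * of_int m) * fourier (g j) \<gamma>))\<^sup>2) \<partial>lebesgue))
    = (\<integral>\<^sup>+\<gamma>. ennreal (1 / c j * (norm (fourier (g j) \<gamma>))\<^sup>2) *
     (\<integral>\<^sup>+m. ennreal ((norm (fourier f (\<gamma> + inverse (c j) * of_int m)))\<^sup>2) \<partial>count_space (UNIV :: int set))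
        * indicator S \<gamma> \<partial>lebesgue)" if j: "j \<in> J" for j
  proof -
    note [measurable] = borel_measurable_fourier_g[OF j] borel_measurable_fourier_translate[OF f]
    have "(\<Sum>\<^sub>\<infinity>m\<in>(UNIV :: int set). ennreal (1 / c j) *
        (\<integral>\<^sup>+\<gamma>\<in>S. ennreal ((norm (fourier f (\<gamma> + inverse (c j) * of_int m) * fourier (g j) \<gamma>))\<^sup>2) \<partial>lebesgue))
      = (\<integral>\<^sup>+m. \<integral>\<^sup>+\<gamma>. ennreal (1 / c j) *
        (ennreal ((norm (fourier f (\<gamma> + inverse (c j) * of_int m) * fourier (g j) \<gamma>))\<^sup>2) * indicator S \<gamma>)
          \<partial>lebesgue \<partial>count_space (UNIV :: int set))"
      by (simp add: infsum_eq_nn_integral_count_space nn_integral_cmult)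
    also have "\<dots> = (\<integral>\<^sup>+\<gamma>. \<integral>\<^sup>+m. ennreal (1 / c j) *
        (ennreal ((norm (fourier f (\<gamma> + inverse (c j) * of_int m) * fourier (g j) \<gamma>))\<^sup>2) * indicator S \<gamma>)
          \<partial>count_space (UNIV :: int set) \<partial>lebesgue)"
      by (rule nn_integral_count_space_nn_integral[symmetric]) auto
    also have "\<dots> = (\<integral>\<^sup>+\<gamma>. ennreal (1 / c j * (norm (fourier (g j) \<gamma>))\<^sup>2) *
       (\<integral>\<^sup>+m. ennreal ((norm (fourier f (\<gamma> + inverse (c j) * of_int m)))\<^sup>2) \<partial>count_space (UNIV :: int set))
        * indicator S \<gamma> \<partial>lebesgue)"
    proof (rule nn_integral_cong)
      fix \<gamma>
      have "ennreal (1 / c j) *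
          (ennreal ((norm (fourier f (\<gamma> + inverse (c j) * of_int m) * fourier (g j) \<gamma>))\<^sup>2) * indicator S \<gamma>)
        = ennreal (1 / c j * (norm (fourier (g j) \<gamma>))\<^sup>2) * indicator S \<gamma> *
          ennreal ((norm (fourier f (\<gamma> + inverse (c j) * of_int m)))\<^sup>2)" for m
      proof -
        have "ennreal (1 / c j * (norm (fourier (g j) \<gamma>))\<^sup>2) = ennreal (1 / c j) * ennreal ((norm (fourier (g j) \<gamma>))\<^sup>2)"
          using c_pos[OF j] by (intro ennreal_mult') simp
        moreover have "ennreal ((norm (fourier f (\<gamma> + inverse (c j) * of_int m) * fourier (g j) \<gamma>))\<^sup>2)
            = ennreal ((norm (fourier f (\<gamma> + inverse (c j) * of_int m)))\<^sup>2) * ennreal ((norm (fourier (g j) \<gamma>))\<^sup>2)"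
          by (simp add: norm_mult power_mult_distrib ennreal_mult')
        ultimately show ?thesis by (simp only: mult_ac)
      qed
      then show "(\<integral>\<^sup>+m. ennreal (1 / c j) *
          (ennreal ((norm (fourier f (\<gamma> + inverse (c j) * of_int m) * fourier (g j) \<gamma>))\<^sup>2) * indicator S \<gamma>)
            \<partial>count_space (UNIV :: int set))
        = ennreal (1 / c j * (norm (fourier (g j) \<gamma>))\<^sup>2) *
         (\<integral>\<^sup>+m. ennreal ((norm (fourier f (\<gamma> + inverse (c j) * of_int m)))\<^sup>2) \<partial>count_space (UNIV :: int set))
          * indicator S \<gamma>"
        by (simp only: nn_integral_cmult borel_measurable_count_space) (simp only: mult_ac)
    qed
    finally show ?thesis .
  qed
  have "LIC_sum J c g f = (\<integral>\<^sup>+j. \<integral>\<^sup>+\<gamma>. ennreal (1 / c j * (norm (fourier (g j) \<gamma>))\<^sup>2) *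
     (\<integral>\<^sup>+m. ennreal ((norm (fourier f (\<gamma> + inverse (c j) * of_int m)))\<^sup>2) \<partial>count_space (UNIV :: int set))
        * indicator S \<gamma> \<partial>lebesgue \<partial>count_space J)"
    unfolding LIC_sum_def S_def[symmetric] infsum_eq_nn_integral_count_space[OF J]
    by (intro nn_integral_cong) (simp add: inner)
  also have "\<dots> = (\<integral>\<^sup>+\<gamma>. \<integral>\<^sup>+j. ennreal (1 / c j * (norm (fourier (g j) \<gamma>))\<^sup>2) *
     (\<integral>\<^sup>+m. ennreal ((norm (fourier f (\<gamma> + inverse (c j) * of_int m)))\<^sup>2) \<partial>count_space (UNIV :: int set))
        * indicator S \<gamma> \<partial>count_space J \<partial>lebesgue)"
    using S by (intro nn_integral_count_space_nn_integral[symmetric] J borel_measurable_times_ennreal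
        borel_measurable_LIC_summand f) auto
  also have "\<dots> = (\<integral>\<^sup>+\<gamma>\<in>S. LIC_density J c g f \<gamma> \<partial>lebesgue)"
    by (simp add: LIC_density_def nn_integral_multc)
  finally show ?thesis by (simp add: S_def)
qed

end

text \<open>Take the points that are nearer to \<open>K\<close> than to \<open>E\<close> and at
  distance less than 1 from \<open>K\<close>. A point of \<open>E\<close> in the closure would have
  distance 0 to \<open>K\<close>. Points of \<open>K\<close> in the closure of \<open>E\<close> must
  be given up, since every open set around them meets \<open>E\<close>.\<close>

lemma exists_open_near_compact:
  fixes K E :: "real set"
  assumes K: "compact K" "K \<inter> E = {}"
  obtains U where "open U" "bounded U" "K - closure E \<subseteq> U" "closure U \<inter> E = {}"
proof (cases "K = {}")
  case True
  with that[of "{}"] show thesis by simp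
next
  case False
  have "K \<noteq> UNIV"
    using K(1) compact_imp_bounded not_bounded_UNIV by blast
  then obtain z where z: "z \<notin> K" by auto
  \<comment> \<open>\<open>infdist\<close> to the empty set is 0, which would make \<open>U\<close>
    empty when \<open>E\<close> is. Adjoining a point outside \<open>K\<close> avoids this and keeps
    the sets disjoint.\<close>
  define E' where "E' = insert z E"
  have E': "E' \<noteq> {}" "K \<inter> E' = {}"
    using K(2) z by (auto simp: E'_def)
  define U where "U = {y. infdist y K < infdist y E'} \<inter> {y. infdist y K < 1}"
  have closed: "closed K" using K(1) by (rule compact_imp_closed)
  show thesis
  proof (rule that[of U])
    show "open U"
      unfolding U_def by (intro open_Int open_Collect_less continuous_intros)
    show "bounded U"
    proof -
      obtain R where R: "\<And>x. x \<in> K \<Longrightarrow> \<bar>x\<bar> \<le> R"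
        using compact_imp_bounded[OF K(1)] by (auto simp: bounded_real)
      have "\<bar>y\<bar> \<le> R + 1" if y: "y \<in> U" for y
      proof -
        obtain x where x: "x \<in> K" "infdist y K = dist y x"
          using infdist_attains_inf[OF closed False] by blast
        with y have "dist y x < 1" by (simp add: U_def)
        with R[OF x(1)] show ?thesis by (simp add: dist_real_def)
      qed
      then show ?thesis by (auto simp: bounded_real)
    qed
    show "K - closure E \<subseteq> U"
    proof
      fix x
      assume x: "x \<in> K - closure E"
      then have "x \<notin> closure E'" using z by (auto simp: E'_def closure_insert)
      then have "0 < infdist x E'"
        using in_closure_iff_infdist_zero[OF E'(1)] infdist_nonneg[of x E'] by (metis less_le)
      moreover have "infdist x K = 0" using x by simp
      ultimately show "x \<in> U" by (simp add: U_def)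
    qed
    have "closed {y. infdist y K \<le> infdist y E'}"
      by (intro closed_Collect_le continuous_intros)
    then have "closure U \<subseteq> {y. infdist y K \<le> infdist y E'}"
      by (rule closure_minimal[rotated]) (auto simp: U_def)
    moreover have False if "y \<in> E" "infdist y K \<le> infdist y E'" for y
    proof -
      have "infdist y E' = 0" using that(1) by (simp add: E'_def)
      with that(2) infdist_nonneg[of y K] have "infdist y K = 0" by simp
      then have "y \<in> K" using in_closed_iff_infdist_zero[OF closed False] by simp
      with that(1) K(2) show False by auto
    qed
    ultimately show "closure U \<inter> E = {}" by auto
  qed
qed

text \<open>At most \<open>2 * R * c j + 1\<close> points of the progression lie in the interval.
  After division by \<open>c j\<close> the main term yields the unweighted sum and the error 1 the
  weighted one.\<close>

lemma LIC_density_AE_le: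
  assumes J: "countable J" and c_pos: "\<And>j. j \<in> J \<Longrightarrow> c j > 0"
    and "0 \<le> R" and F: "AE \<gamma> in lebesgue. (norm (fourier f \<gamma>))\<^sup>2 \<le> b * indicator {- R..R} \<gamma>" and "0 \<le> b"
  shows "AE \<gamma> in lebesgue. LIC_density J c g f \<gamma>
    \<le> ennreal (b * (2 * R)) * (\<integral>\<^sup>+j. ennreal ((norm (fourier (g j) \<gamma>))\<^sup>2) \<partial>count_space J)
      + ennreal b * (\<integral>\<^sup>+j. ennreal (1 / c j * (norm (fourier (g j) \<gamma>))\<^sup>2) \<partial>count_space J)"
  using AE_arithmetic_progressions[OF J F, of c]
proof eventually_elim
  fix \<gamma>
  assume bound: "\<forall>j\<in>J. \<forall>m::int. (norm (fourier f (\<gamma> + inverse (c j) * of_int m)))\<^sup>2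
    \<le> b * indicator {- R..R} (\<gamma> + inverse (c j) * of_int m)"
  have "LIC_density J c g f \<gamma> \<le> (\<integral>\<^sup>+j. ennreal (b * (2 * R)) * ennreal ((norm (fourier (g j) \<gamma>))\<^sup>2)
      + ennreal b * ennreal (1 / c j * (norm (fourier (g j) \<gamma>))\<^sup>2) \<partial>count_space J)"
    unfolding LIC_density_def
  proof (rule nn_integral_mono)
    fix j
    assume "j \<in> space (count_space J)"
    then have j: "j \<in> J" and c: "0 < c j" using c_pos by auto
    define G where "G = (norm (fourier (g j) \<gamma>))\<^sup>2"
    have "0 \<le> G" by (simp add: G_def)
    have "(\<integral>\<^sup>+m. ennreal ((norm (fourier f (\<gamma> + inverse (c j) * of_int m)))\<^sup>2) \<partial>count_space (UNIV :: int set))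
        \<le> (\<integral>\<^sup>+m. ennreal b * indicator {- R..R} (\<gamma> + inverse (c j) * of_int m) \<partial>count_space (UNIV :: int set))"
    proof (rule nn_integral_mono)
      fix m :: int
      show "ennreal ((norm (fourier f (\<gamma> + inverse (c j) * of_int m)))\<^sup>2)
          \<le> ennreal b * indicator {- R..R} (\<gamma> + inverse (c j) * of_int m)"
        using ennreal_leI[OF bound[rule_format, OF j, of m]]
        by (cases "\<gamma> + inverse (c j) * of_int m \<in> {- R..R}") (simp_all del: atLeastAtMost_iff)
    qed
    also have "\<dots> \<le> ennreal b * ennreal (c j * (R - - R) + 1)"
      using c \<open>0 \<le> R\<close>
      by (subst nn_integral_cmult, simp, intro mult_left_mono nn_integral_arithmetic_progression_le) simp_all
    finally have "ennreal (1 / c j * G) * (\<integral>\<^sup>+m. ennreal ((norm (fourier f (\<gamma> + inverse (c j) * of_int m)))\<^sup>2) \<partial>count_space (UNIV :: int set))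
        \<le> ennreal (1 / c j * G) * (ennreal b * ennreal (c j * (R - - R) + 1))"
      by (intro mult_left_mono) auto
    also have "\<dots> = ennreal (1 / c j * G * (b * (c j * (R - - R) + 1)))"
      using c \<open>0 \<le> b\<close> \<open>0 \<le> R\<close> \<open>0 \<le> G\<close> by (subst ennreal_mult', simp, subst (2) ennreal_mult') simp_all
    also have "1 / c j * G * (b * (c j * (R - - R) + 1)) = b * (2 * R) * G + b * (1 / c j * G)"
      using c by (simp add: field_simps)
    also have "ennreal \<dots> = ennreal (b * (2 * R)) * ennreal G + ennreal b * ennreal (1 / c j * G)"
    proof -
      have "0 \<le> b * (2 * R)" "0 \<le> 1 / c j * G"
        using c \<open>0 \<le> b\<close> \<open>0 \<le> R\<close> \<open>0 \<le> G\<close> by simp_all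
      then show ?thesis
        using \<open>0 \<le> b\<close> \<open>0 \<le> G\<close>
        by (simp only: ennreal_plus ennreal_mult[of "b * (2 * R)"] ennreal_mult[of b "1 / c j * G"] mult_nonneg_nonneg)
    qed
    finally show "ennreal (1 / c j * (norm (fourier (g j) \<gamma>))\<^sup>2)
        * (\<integral>\<^sup>+m. ennreal ((norm (fourier f (\<gamma> + inverse (c j) * of_int m)))\<^sup>2) \<partial>count_space (UNIV :: int set))
      \<le> ennreal (b * (2 * R)) * ennreal ((norm (fourier (g j) \<gamma>))\<^sup>2)
        + ennreal b * ennreal (1 / c j * (norm (fourier (g j) \<gamma>))\<^sup>2)"
      by (simp only: G_def)
  qed
  then show "LIC_density J c g f \<gamma>
    \<le> ennreal (b * (2 * R)) * (\<integral>\<^sup>+j. ennreal ((norm (fourier (g j) \<gamma>))\<^sup>2) \<partial>count_space J)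
      + ennreal b * (\<integral>\<^sup>+j. ennreal (1 / c j * (norm (fourier (g j) \<gamma>))\<^sup>2) \<partial>count_space J)"
    by (simp add: nn_integral_add nn_integral_cmult)
qed

text \<open>At least \<open>c j * (v - u) - 1\<close> points of the progression lie in the interval,
  each contributing at least the square of \<open>\<delta>\<close>. Solving for the squared norm of
  \<open>fourier (g j)\<close> leaves the density and, from the error 1, the weighted sum.\<close>

lemma LIC_density_AE_ge:
  assumes J: "countable J" and c_pos: "\<And>j. j \<in> J \<Longrightarrow> c j > 0"
    and "u < v" "0 < \<delta>" and F: "AE \<gamma> in lebesgue. \<gamma> \<in> {u..v} \<longrightarrow> \<delta> \<le> norm (fourier f \<gamma>)"
  shows "AE \<gamma> in lebesgue. (\<integral>\<^sup>+j. ennreal ((norm (fourier (g j) \<gamma>))\<^sup>2) \<partial>count_space J)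
    \<le> ennreal (1 / (\<delta>\<^sup>2 * (v - u))) * LIC_density J c g f \<gamma>
      + ennreal (1 / (v - u)) * (\<integral>\<^sup>+j. ennreal (1 / c j * (norm (fourier (g j) \<gamma>))\<^sup>2) \<partial>count_space J)"
  using AE_arithmetic_progressions[OF J F, of c]
proof eventually_elim
  fix \<gamma>
  assume bound: "\<forall>j\<in>J. \<forall>m::int. \<gamma> + inverse (c j) * of_int m \<in> {u..v}
    \<longrightarrow> \<delta> \<le> norm (fourier f (\<gamma> + inverse (c j) * of_int m))"
  define H where "H j = (\<integral>\<^sup>+m. ennreal ((norm (fourier f (\<gamma> + inverse (c j) * of_int m)))\<^sup>2) \<partial>count_space (UNIV :: int set))" for j
  have "(\<integral>\<^sup>+j. ennreal ((norm (fourier (g j) \<gamma>))\<^sup>2) \<partial>count_space J)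
    \<le> (\<integral>\<^sup>+j. ennreal (1 / (\<delta>\<^sup>2 * (v - u))) * (ennreal (1 / c j * (norm (fourier (g j) \<gamma>))\<^sup>2) * H j)
      + ennreal (1 / (v - u)) * ennreal (1 / c j * (norm (fourier (g j) \<gamma>))\<^sup>2) \<partial>count_space J)"
  proof (rule nn_integral_mono)
    fix j
    assume "j \<in> space (count_space J)"
    then have j: "j \<in> J" and c: "0 < c j" using c_pos by auto
    define G where "G = (norm (fourier (g j) \<gamma>))\<^sup>2"
    \<comment> \<open>The lower bound for the number of points, clipped at 0 so that products pass
      through \<open>ennreal\<close>; \<open>n + 1\<close> still dominates
      \<open>c j * (v - u)\<close>.\<close>
    define n where "n = max 0 (c j * (v - u) - 1)"
    have "0 \<le> G" by (simp add: G_def)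
    have "ennreal n = ennreal (c j * (v - u) - 1)"
      by (simp add: n_def max_def ennreal_neg)
    then have "ennreal (\<delta>\<^sup>2 * n) \<le> ennreal (\<delta>\<^sup>2) *
        (\<integral>\<^sup>+m. indicator {u..v} (\<gamma> + inverse (c j) * real_of_int m) \<partial>count_space UNIV)"
      using nn_integral_arithmetic_progression_ge[OF c, of v u \<gamma>]
      by (subst ennreal_mult') (auto intro!: mult_left_mono)
    also have "\<dots> = (\<integral>\<^sup>+m. ennreal (\<delta>\<^sup>2) * indicator {u..v} (\<gamma> + inverse (c j) * of_int m) \<partial>count_space (UNIV :: int set))"
      by (subst nn_integral_cmult) simp_all
    also have "\<dots> \<le> H j"
      unfolding H_def using bound j \<open>0 < \<delta>\<close>
      by (intro nn_integral_mono) (auto simp: indicator_def intro!: ennreal_leI power_mono)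
    finally have H: "ennreal (\<delta>\<^sup>2 * n) \<le> H j" .
    have "c j * (v - u) \<le> n + 1" by (simp add: n_def)
    then have "c j * (v - u) * G \<le> (n + 1) * G"
      using \<open>0 \<le> G\<close> by (rule mult_right_mono)
    moreover define l where "l = v - u"
    ultimately have "G \<le> (n + 1) * G / (c j * l)"
      using c \<open>u < v\<close> by (simp add: pos_le_divide_eq mult.commute)
    \<comment> \<open>Split \<open>n + 1\<close>: the part with \<open>n\<close> is matched to the
      lower bound for \<open>H j\<close>, the part with 1 is the weighted term.\<close>
    also have "\<dots> = 1 / (\<delta>\<^sup>2 * l) * (1 / c j * G * (\<delta>\<^sup>2 * n)) + 1 / l * (1 / c j * G)"
      using c \<open>u < v\<close> \<open>0 < \<delta>\<close> by (simp add: l_def[symmetric] field_simps add_divide_distrib)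
    finally have "G \<le> 1 / (\<delta>\<^sup>2 * (v - u)) * (1 / c j * G * (\<delta>\<^sup>2 * n)) + 1 / (v - u) * (1 / c j * G)"
      by (simp only: l_def)
    then have "ennreal G \<le> ennreal (1 / (\<delta>\<^sup>2 * (v - u)) * (1 / c j * G * (\<delta>\<^sup>2 * n)) + 1 / (v - u) * (1 / c j * G))"
      by (rule ennreal_leI)
    also have "\<dots> = ennreal (1 / (\<delta>\<^sup>2 * (v - u))) * (ennreal (1 / c j * G) * ennreal (\<delta>\<^sup>2 * n))
        + ennreal (1 / (v - u)) * ennreal (1 / c j * G)"
    proof -
      have "0 \<le> 1 / (\<delta>\<^sup>2 * (v - u))" "0 \<le> 1 / c j * G" "0 \<le> \<delta>\<^sup>2 * n" "0 \<le> 1 / (v - u)"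
        using c \<open>u < v\<close> \<open>0 \<le> G\<close> by (auto simp: n_def)
      then show ?thesis
        by (simp only: ennreal_plus ennreal_mult mult_nonneg_nonneg)
    qed
    also have "\<dots> \<le> ennreal (1 / (\<delta>\<^sup>2 * (v - u))) * (ennreal (1 / c j * G) * H j)
        + ennreal (1 / (v - u)) * ennreal (1 / c j * G)"
      by (intro add_right_mono mult_left_mono H) auto
    finally show "ennreal ((norm (fourier (g j) \<gamma>))\<^sup>2)
      \<le> ennreal (1 / (\<delta>\<^sup>2 * (v - u))) * (ennreal (1 / c j * (norm (fourier (g j) \<gamma>))\<^sup>2) * H j)
        + ennreal (1 / (v - u)) * ennreal (1 / c j * (norm (fourier (g j) \<gamma>))\<^sup>2)"
      by (simp only: G_def)
  qed
  then show "(\<integral>\<^sup>+j. ennreal ((norm (fourier (g j) \<gamma>))\<^sup>2) \<partial>count_space J)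
    \<le> ennreal (1 / (\<delta>\<^sup>2 * (v - u))) * LIC_density J c g f \<gamma>
      + ennreal (1 / (v - u)) * (\<integral>\<^sup>+j. ennreal (1 / c j * (norm (fourier (g j) \<gamma>))\<^sup>2) \<partial>count_space J)"
    by (simp add: nn_integral_add nn_integral_cmult LIC_density_def H_def)
qed

text \<open>The last step of both implications: with \<open>K = S\<close> it bounds the density by
  the two sums, and for a general compact \<open>K\<close> it bounds the unweighted sum by the
  density and the weighted sum.\<close>

lemma nn_integral_finite_of_AE_le:
  assumes le: "AE x in M. h x * indicator K x \<le> (ennreal a * T x + ennreal b * s x) * indicator S x"
    and [measurable]: "T \<in> borel_measurable M" "s \<in> borel_measurable M" "S \<in> sets M"
    and T: "(\<integral>\<^sup>+x\<in>S. T x \<partial>M) < \<infinity>" and s: "(\<integral>\<^sup>+x\<in>S. s x \<partial>M) < \<infinity>"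
  shows "(\<integral>\<^sup>+x\<in>K. h x \<partial>M) < \<infinity>"
proof -
  have "(\<integral>\<^sup>+x\<in>K. h x \<partial>M) \<le> (\<integral>\<^sup>+x. ennreal a * (T x * indicator S x) + ennreal b * (s x * indicator S x) \<partial>M)"
    using le by (intro nn_integral_mono_AE) (auto simp: distrib_right mult.assoc)
  also have "\<dots> = ennreal a * (\<integral>\<^sup>+x\<in>S. T x \<partial>M) + ennreal b * (\<integral>\<^sup>+x\<in>S. s x \<partial>M)"
    by (simp add: nn_integral_add nn_integral_cmult)
  also have "\<dots> < \<infinity>"
    using T s by (simp add: ennreal_mult_less_top)
  finally show ?thesis .
qed

theorem proposition3p3:
  fixes J :: "'j set"
    and c :: "'j \<Rightarrow> real"
    and g :: "'j \<Rightarrow> real \<Rightarrow> complex"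
    and E :: "real set"
  assumes "countable J"
    and "\<And>j. j \<in> J \<Longrightarrow> c j > 0"
    and "\<And>j. j \<in> J \<Longrightarrow> g j \<in> L2"
    and "E \<in> sets lebesgue"
    and "emeasure lebesgue (closure E) = 0"
    and "(\<lambda>\<gamma>. \<Sum>\<^sub>\<infinity>j\<in>J. ennreal (1 / c j * (norm (fourier (g j) \<gamma>))\<^sup>2)) \<in> L1_loc (- E)"
  shows "LIC J c g E \<longleftrightarrow>
    (\<lambda>\<gamma>. \<Sum>\<^sub>\<infinity>j\<in>J. ennreal ((norm (fourier (g j) \<gamma>))\<^sup>2)) \<in> L1_loc (- E)"
proof -
  note J = assms(1) and c_pos = assms(2) and g_L2 = assms(3)
  define s where "s \<gamma> = (\<integral>\<^sup>+j. ennreal (1 / c j * (norm (fourier (g j) \<gamma>))\<^sup>2) \<partial>count_space J)" for \<gamma>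
  define h where "h \<gamma> = (\<integral>\<^sup>+j. ennreal ((norm (fourier (g j) \<gamma>))\<^sup>2) \<partial>count_space J)" for \<gamma>
  note sum_eq = infsum_eq_nn_integral_count_space[OF J]
  have s_loc: "s \<in> L1_loc (- E)"
    using assms(6) by (simp add: s_def[abs_def] sum_eq)
  then have s_meas: "s \<in> borel_measurable lebesgue"
    and s_int: "\<And>K. compact K \<Longrightarrow> K \<subseteq> - E \<Longrightarrow> (\<integral>\<^sup>+x\<in>K. s x \<partial>lebesgue) < \<infinity>"
    by (auto simp: L1_loc_def)
  have h_meas: "h \<in> borel_measurable lebesgue"
    unfolding h_def[abs_def]
  proof (rule borel_measurable_nn_integral_count_space[OF J])
    fix j assume "j \<in> J"
    note [measurable] = borel_measurable_fourier_g[OF J c_pos g_L2 this]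
    show "(\<lambda>\<gamma>. ennreal ((norm (fourier (g j) \<gamma>))\<^sup>2)) \<in> borel_measurable lebesgue"
      by measurable
  qed
  have LIC_sum_eq: "LIC_sum J c g f = (\<integral>\<^sup>+\<gamma>\<in>ess_supp (fourier f). LIC_density J c g f \<gamma> \<partial>lebesgue)"
    if "f \<in> L2" for f
    by (rule LIC_sum_eq_integral_density) (use J c_pos g_L2 that in auto)
  have T_meas: "LIC_density J c g f \<in> borel_measurable lebesgue" if "f \<in> L2" for f
    by (rule borel_measurable_LIC_density) (use J c_pos g_L2 that in auto)
  have "LIC J c g E \<longleftrightarrow> h \<in> L1_loc (- E)"
  proof
    assume h_loc: "h \<in> L1_loc (- E)"
    show "LIC J c g E"
      unfolding LIC_def
    proof
      fix f
      assume f: "f \<in> D_space E"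
      define S where "S = ess_supp (fourier f)"
      have f_L2: "f \<in> L2" and S: "compact S" "S \<subseteq> - E" and Linf: "fourier f \<in> Linf"
        using f by (auto simp: D_space_def S_def)
      obtain B where B: "AE \<gamma> in lebesgue. norm (fourier f \<gamma>) \<le> B"
        using Linf by (auto simp: Linf_def)
      obtain R where R: "\<And>x. x \<in> S \<Longrightarrow> \<bar>x\<bar> \<le> R"
        using compact_imp_bounded[OF S(1)] by (auto simp: bounded_real)
      \<comment> \<open>The absolute value covers an empty \<open>S\<close>, for which
        \<open>R\<close> may be negative.\<close>
      have "AE \<gamma> in lebesgue. (norm (fourier f \<gamma>))\<^sup>2 \<le> B\<^sup>2 * indicator {- \<bar>R\<bar>..\<bar>R\<bar>} \<gamma>"
        using B AE_eq_0_outside_ess_supp[of "fourier f"]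
      proof eventually_elim
        fix \<gamma>
        assume le: "norm (fourier f \<gamma>) \<le> B" and eq0: "\<gamma> \<notin> ess_supp (fourier f) \<longrightarrow> fourier f \<gamma> = 0"
        show "(norm (fourier f \<gamma>))\<^sup>2 \<le> B\<^sup>2 * indicator {- \<bar>R\<bar>..\<bar>R\<bar>} \<gamma>"
        proof (cases "\<gamma> \<in> S")
          case True
          then have "\<gamma> \<in> {- \<bar>R\<bar>..\<bar>R\<bar>}" using R[of \<gamma>] by auto
          with le show ?thesis by (simp add: power_mono)
        next
          case False
          with eq0 show ?thesis by (simp add: S_def)
        qed
      qed
      then have "AE \<gamma> in lebesgue. LIC_density J c g f \<gamma> \<le> ennreal (B\<^sup>2 * (2 * \<bar>R\<bar>)) * h \<gamma> + ennreal (B\<^sup>2) * s \<gamma>"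
        unfolding h_def s_def by (intro LIC_density_AE_le J c_pos) auto
      then have "AE \<gamma> in lebesgue. LIC_density J c g f \<gamma> * indicator S \<gamma>
          \<le> (ennreal (B\<^sup>2 * (2 * \<bar>R\<bar>)) * h \<gamma> + ennreal (B\<^sup>2) * s \<gamma>) * indicator S \<gamma>"
        by eventually_elim (rule mult_right_mono, auto)
      then have "(\<integral>\<^sup>+\<gamma>\<in>S. LIC_density J c g f \<gamma> \<partial>lebesgue) < \<infinity>"
      proof (rule nn_integral_finite_of_AE_le[OF _ h_meas s_meas])
        show "S \<in> sets lebesgue"
          using S(1) by (intro sets_completionI_sets) (simp add: compact_imp_closed)
        show "(\<integral>\<^sup>+\<gamma>\<in>S. h \<gamma> \<partial>lebesgue) < \<infinity>"
          using h_loc S by (simp add: L1_loc_def)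
        show "(\<integral>\<^sup>+\<gamma>\<in>S. s \<gamma> \<partial>lebesgue) < \<infinity>"
          using S by (rule s_int)
      qed
      then show "LIC_sum J c g f < \<infinity>"
        by (simp add: LIC_sum_eq[OF f_L2] S_def)
    qed
  next
    assume LIC: "LIC J c g E"
    show "h \<in> L1_loc (- E)"
      unfolding L1_loc_def
    proof (intro CollectI conjI h_meas allI impI)
      fix K :: "real set"
      assume K: "compact K" "K \<subseteq> - E"
      \<comment> \<open>Adjoining a point off the closure of \<open>E\<close> makes \<open>U\<close>
        nonempty even if \<open>K\<close> is empty or contained in that closure.\<close>
      have "closure E \<noteq> UNIV"
        using assms(5) by auto
      then obtain w where w: "w \<notin> closure E" by auto
      then have "w \<notin> E" using closure_subset by blast
      then have "compact (insert w K)" "insert w K \<inter> E = {}"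
        using K by auto
      then obtain U where U: "open U" "bounded U" "insert w K - closure E \<subseteq> U" "closure U \<inter> E = {}"
        by (rule exists_open_near_compact)
      have "U \<noteq> {}" using U(3) w by auto
      \<comment> \<open>The support of this transform lies between \<open>U\<close> and the closure
        of \<open>U\<close>, which is compact and disjoint from \<open>E\<close>; hence
        \<open>f\<close> is an admissible test function.\<close>
      obtain f F where f: "integrable lebesgue f" "f \<in> L2" and f_F: "\<And>\<gamma>. fourier_L1 f \<gamma> = of_real (F \<gamma>)"
        and F_nonneg: "\<And>\<gamma>. 0 \<le> F \<gamma>" and F_pos: "\<And>\<gamma>. 0 < F \<gamma> \<longleftrightarrow> \<gamma> \<in> U"
        and F_ge: "\<exists>u v \<delta>. u < v \<and> 0 < \<delta> \<and> (\<forall>\<gamma>\<in>{u..v}. \<delta> \<le> F \<gamma>)"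
        by (rule exists_L1_L2_with_nonneg_transform[OF U(1) \<open>U \<noteq> {}\<close>]) (rule that)
      have fourier_f: "AE \<gamma> in lebesgue. fourier f \<gamma> = fourier_L1 f \<gamma>"
        by (rule fourier_eq_fourier_L1_AE[OF f])
      define S where "S = ess_supp (fourier f)"
      have S_eq: "S = ess_supp (fourier_L1 f)"
        unfolding S_def by (rule ess_supp_cong_AE[OF fourier_f])
      have "fourier_L1 f \<gamma> \<noteq> 0 \<longleftrightarrow> \<gamma> \<in> U" for \<gamma>
        using F_nonneg[of \<gamma>] F_pos[of \<gamma>] by (auto simp: f_F less_le)
      from ess_supp_between[OF U(1) this] have S: "U \<subseteq> S" "S \<subseteq> closure U"
        by (auto simp: S_eq)
      have "closed S" unfolding S_def by (rule closed_ess_supp)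
      moreover have "bounded S"
        using S(2) U(2) by (auto intro: bounded_subset)
      ultimately have S_compact: "compact S" by (simp add: compact_eq_bounded_closed)
      have S_E: "S \<subseteq> - E" using S(2) U(4) by auto
      have "fourier f \<in> Linf"
      proof -
        have "AE \<gamma> in lebesgue. norm (fourier f \<gamma>) \<le> (LINT x|lebesgue. norm (f x))"
          using fourier_f by eventually_elim (simp add: norm_fourier_L1_le)
        then show ?thesis
          using fourier_in_L2[OF f(2)] by (auto simp: Linf_def L2_def)
      qed
      then have "f \<in> D_space E"
        using f(2) S_compact S_E by (simp add: D_space_def S_def)
      then have T_int: "(\<integral>\<^sup>+\<gamma>\<in>S. LIC_density J c g f \<gamma> \<partial>lebesgue) < \<infinity>"
        using LIC by (auto simp: LIC_def LIC_sum_eq[OF f(2)] S_def)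
      obtain u v \<delta> where uv: "u < v" "0 < \<delta>" and \<delta>: "\<And>\<gamma>. \<gamma> \<in> {u..v} \<Longrightarrow> \<delta> \<le> F \<gamma>"
        using F_ge by auto
      have "AE \<gamma> in lebesgue. \<gamma> \<in> {u..v} \<longrightarrow> \<delta> \<le> norm (fourier f \<gamma>)"
        using fourier_f by eventually_elim (use \<delta> F_nonneg in \<open>simp add: f_F\<close>)
      then have "AE \<gamma> in lebesgue. h \<gamma> \<le> ennreal (1 / (\<delta>\<^sup>2 * (v - u))) * LIC_density J c g f \<gamma> + ennreal (1 / (v - u)) * s \<gamma>"
        unfolding h_def s_def by (intro LIC_density_AE_ge J c_pos uv)
      \<comment> \<open>Off this null set every point of \<open>K\<close> lies in \<open>U\<close>,
        hence in the support \<open>S\<close> over which the density is integrated.\<close>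
      moreover have "AE \<gamma> in lebesgue. \<gamma> \<notin> closure E"
        using assms(5) by (intro AE_not_in) (auto simp: null_sets_def intro: sets_completionI_sets)
      ultimately have "AE \<gamma> in lebesgue. h \<gamma> * indicator K \<gamma>
          \<le> (ennreal (1 / (\<delta>\<^sup>2 * (v - u))) * LIC_density J c g f \<gamma> + ennreal (1 / (v - u)) * s \<gamma>) * indicator S \<gamma>"
      proof eventually_elim
        fix \<gamma>
        assume le: "h \<gamma> \<le> ennreal (1 / (\<delta>\<^sup>2 * (v - u))) * LIC_density J c g f \<gamma> + ennreal (1 / (v - u)) * s \<gamma>"
          and "\<gamma> \<notin> closure E"
        then have "\<gamma> \<in> K \<Longrightarrow> \<gamma> \<in> S" using U(3) S(1) by auto
        with le show "h \<gamma> * indicator K \<gamma>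
          \<le> (ennreal (1 / (\<delta>\<^sup>2 * (v - u))) * LIC_density J c g f \<gamma> + ennreal (1 / (v - u)) * s \<gamma>) * indicator S \<gamma>"
          by (auto simp: indicator_def)
      qed
      then show "(\<integral>\<^sup>+\<gamma>\<in>K. h \<gamma> \<partial>lebesgue) < \<infinity>"
      proof (rule nn_integral_finite_of_AE_le[OF _ T_meas[OF f(2)] s_meas])
        show "S \<in> sets lebesgue"
          using S_compact by (intro sets_completionI_sets) (simp add: compact_imp_closed)
      qed (rule T_int s_int S_compact S_E)+
    qed
  qed
  then show ?thesis
    by (simp add: h_def[abs_def] sum_eq)
qed

end
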